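(* Let $\mathcal{X}$ and $\mathcal{Y}$ be compact subsets of $\mathbb{R}^p$ and $\mathbb{R}^q$ respectively, with $p\ge q$, and let $\mu\in\mathcal{P}(\mathcal{X})$, $\nu\in\mathcal{P}(\mathcal{Y})$. Assume that $\mu$ is absolutely continuous with respect to the Lebesgue measure on $\mathbb{R}^p$ and, without loss of generality, that $\mathbb{E}_{X\sim\mu}[X]=0$ and $\mathbb{E}_{Y\sim\nu}[Y]=0$. Let $(\pi^*,\mathbf{P}^* )$ be an optimal solution of $$\sup_{\pi\in\Pi(\mu,\nu)}\ \sup_{\mathbf{P}\in\mathbb{R}^{q\times p}}\int\big(\langle\mathbf{P}\mathbf{x},\mathbf{y}\rangle_q+\|\mathbf{x}\|_2^2\|\mathbf{y}\|_2^2\big)d\pi(\mathbf{x},\mathbf{y})-\frac18\|\mathbf{P}\|_F^2 .$$ If $\mathbf{P}^*$ is surjective, there exists a convex function $u:\mathbb{R}^q\to\mathbb{R}$ such that $\nabla u\circ\mathbf{P}^*$ pushes $\mu$ forward to $\nu$. Moreover, if $\nabla u\circ\mathbf{P}^*\in\mathcal{H}(\mu,\nu)$, then the coupling $\gamma=(\mathrm{id}\times\nabla u\circ\mathbf{P}^* )\#\mu$ is optimal for $$\inf_{\pi\in\Pi(\mu,\nu)}\iint\big(\|\mathbf{x}-\mathbf{x}'\|_2^2-\|\mathbf{y}-\mathbf{y}'\|_2^2\big)^2d\pi(\mathbf{x},\mathbf{y})\,d\pi(\mathbf{x}',\mathbf{y}').$$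
   Context: $\Pi(\mu,\nu)$ is the set of couplings, $\#$ is push-forward, $(\mathrm{id}\times T)\#\mu$ is the push-forward of $\mu$ by $x\mapsto(x,T(x))$, $\|\cdot\|_F$ the Frobenius norm; matrices are identified with linear maps. $\mathcal{H}(\mu,\nu)$ is the set of maps $T$ with $T\#\mu=\nu$ for which there exists a differentiable convex function $f:\mathbb{R}\to\mathbb{R}$ such that $\|T(\mathbf{x})\|_2^2=f'(\|\mathbf{x}\|_2^2)$ for $\mu$-a.e. $\mathbf{x}$. *)

theory Defs
  imports "HOL-Probability.Probability"
begin

definition prob_measure_on :: "'a::euclidean_space set \<Rightarrow> 'a measure \<Rightarrow> bool" where
  "prob_measure_on X \<mu> \<longleftrightarrow> prob_space \<mu> \<and> sets \<mu> = sets borel \<and> emeasure \<mu> X = 1"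

text \<open>Measurability is part of the definition because the library's \<^const>\<open>distr\<close>
  is only meaningful for measurable maps.\<close>

definition pushes_forward :: "('a \<Rightarrow> 'b) \<Rightarrow> 'a measure \<Rightarrow> 'b measure \<Rightarrow> bool" where
  "pushes_forward T \<mu> \<nu> \<longleftrightarrow> T \<in> measurable \<mu> \<nu> \<and> distr \<mu> \<nu> T = \<nu>"

definition couplings :: "'a measure \<Rightarrow> 'b measure \<Rightarrow> ('a \<times> 'b) measure set" where
  "couplings \<mu> \<nu> =
    {\<pi>. prob_space \<pi> \<and> sets \<pi> = sets (\<mu> \<Otimes>\<^sub>M \<nu>) \<and>
         distr \<pi> \<mu> fst = \<mu> \<and> distr \<pi> \<nu> snd = \<nu>}"

definition graph_coupling :: "'a measure \<Rightarrow> 'b measure \<Rightarrow> ('a \<Rightarrow> 'b) \<Rightarrow> ('a \<times> 'b) measure" where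
  "graph_coupling \<mu> \<nu> T = distr \<mu> (\<mu> \<Otimes>\<^sub>M \<nu>) (\<lambda>x. (x, T x))"

text \<open>At a point where \<open>u\<close> has no gradient, \<open>grad u\<close> takes an unspecified value which is
  the same at all such points. A convex \<open>u\<close> on Euclidean space is differentiable
  Lebesgue-almost everywhere.\<close>

definition grad :: "('a::euclidean_space \<Rightarrow> real) \<Rightarrow> 'a \<Rightarrow> 'a" where
  "grad u z = (THE g. GDERIV u z :> g)"

definition radial_maps ::
  "'a::euclidean_space measure \<Rightarrow> 'b::euclidean_space measure \<Rightarrow> ('a \<Rightarrow> 'b) set" where
  "radial_maps \<mu> \<nu> =
    {T. pushes_forward T \<mu> \<nu> \<and>
        (\<exists>f :: real \<Rightarrow> real. convex_on UNIV f \<and> f differentiable_on UNIV \<and>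
           (AE x in \<mu>. (norm (T x))\<^sup>2 = deriv f ((norm x)\<^sup>2)))}"

text \<open>The norm of the library type \<open>real^'p^'q\<close> is the Frobenius norm.\<close>

lemma norm_matrix_frobenius:
  fixes A :: "real^'p^'q"
  shows "norm A = sqrt (\<Sum>i\<in>UNIV. \<Sum>j\<in>UNIV. (A $ i $ j)\<^sup>2)"
  by (simp add: norm_vec_def L2_set_def sum_nonneg)

definition bilinear_objective :: "((real^'p) \<times> (real^'q)) measure \<Rightarrow> real^'p^'q \<Rightarrow> real" where
  "bilinear_objective \<pi> P =
    (\<integral>(x, y). ((P *v x) \<bullet> y + (norm x)\<^sup>2 * (norm y)\<^sup>2) \<partial>\<pi>) - 1/8 * (norm P)\<^sup>2"

definition gw_cost :: "('a::euclidean_space \<times> 'b::euclidean_space) measure \<Rightarrow> real" where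
  "gw_cost \<pi> =
    (\<integral>(x', y'). (\<integral>(x, y). ((norm (x - x'))\<^sup>2 - (norm (y - y'))\<^sup>2)\<^sup>2 \<partial>\<pi>) \<partial>\<pi>)"

end

theory Submission
  imports Defs "HOL-Complex_Analysis.Great_Picard"
begin

text \<open>Expanding the square, the cost of a coupling \<open>\<pi>\<close> of centred measures is a constant minus
  \<open>4 \<integral> \<bar>x\<bar>\<^sup>2 \<bar>y\<bar>\<^sup>2 d\<pi> + 8 \<bar>M\<bar>\<^sup>2\<close> with \<open>M\<close> the cross-covariance matrix of \<open>\<pi>\<close>, and
  \<open>2 \<bar>M\<bar>\<^sup>2\<close> is the maximum over \<open>P\<close> of \<open>\<langle>P, M\<rangle> - \<bar>P\<bar>\<^sup>2 / 8\<close>. A coupling \<open>\<gamma>\<close> is therefore optimal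
  as soon as it does at least as well as \<open>\<pi>opt\<close> in the bilinear problem with \<open>P = Popt\<close>. The graph
  coupling of \<open>\<nabla>u \<circ> Popt\<close> maximizes the two terms separately: the bilinear one because it lives
  on the subdifferential of \<open>u\<close>, the quadratic one because the map is radial, so that \<open>\<bar>y\<bar>\<^sup>2\<close> is a
  subgradient of a convex function at \<open>\<bar>x\<bar>\<^sup>2\<close>.

  The map exists by Brenier's theorem: \<open>Popt\<close> is surjective, so the image of \<open>\<mu>\<close> is absolutely
  continuous. Following Gangbo, \<open>u\<close> is the Legendre transform of a minimizer of the dual functional
  \<open>\<integral> g d\<nu> + \<integral> g\<^sup>* d\<rho>\<close>, and the vanishing first variation says that \<open>\<nabla>u\<close> pushes \<open>\<rho>\<close> to \<open>\<nu>\<close>.\<close>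

section \<open>Null sets and convex functions on the line\<close>

text \<open>Fubini for the indicator of \<open>N\<close> at \<open>R z + x\<close>. By translation
  invariance, integrating over \<open>x\<close> first gives the measure of \<open>N\<close> for
  every \<open>z\<close>, hence that measure times infinity; integrating over \<open>z\<close> first
  gives 0.\<close>

lemma null_sets_lborel_if_translates_null:
  fixes R :: "'b::euclidean_space \<Rightarrow> 'a::euclidean_space"
  assumes R [measurable]: "R \<in> borel_measurable borel"
    and N [measurable]: "N \<in> sets borel"
    and slices: "\<And>x. {z. x + R z \<in> N} \<in> null_sets lborel"
  shows "N \<in> null_sets lborel"
proof -
  have "(\<integral>\<^sup>+ x. indicator N (R z + x) \<partial>lborel) = emeasure lborel N" for z
  proof -
    have "emeasure lborel N = (\<integral>\<^sup>+ x. indicator N x \<partial>(distr lborel borel ((+) (R z))))"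
      by (simp add: lborel_distr_plus)
    also have "\<dots> = (\<integral>\<^sup>+ x. indicator N (R z + x) \<partial>lborel)"
      by (subst nn_integral_distr) auto
    finally show ?thesis ..
  qed
  then have "emeasure lborel N * \<infinity> = (\<integral>\<^sup>+ z. (\<integral>\<^sup>+ x. indicator N (R z + x) \<partial>lborel) \<partial>(lborel :: 'b measure))"
    by (simp add: emeasure_lborel_UNIV)
  also have "\<dots> = (\<integral>\<^sup>+ x. (\<integral>\<^sup>+ z. indicator N (R z + x) \<partial>lborel) \<partial>lborel)"
    by (rule lborel_pair.Fubini'[symmetric]) measurable
  also have "\<dots> = (\<integral>\<^sup>+ x. emeasure (lborel :: 'b measure) {z. x + R z \<in> N} \<partial>lborel)"
  proof (rule nn_integral_cong)
    fix x
    have "(\<integral>\<^sup>+ z. indicator N (R z + x) \<partial>lborel) = (\<integral>\<^sup>+ z. indicator {z. x + R z \<in> N} z \<partial>(lborel :: 'b measure))"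
      by (intro nn_integral_cong) (simp add: indicator_def add.commute)
    also have "\<dots> = emeasure (lborel :: 'b measure) {z. x + R z \<in> N}"
      by (rule nn_integral_indicator) (use slices in \<open>auto simp: null_sets_def\<close>)
    finally show "(\<integral>\<^sup>+ z. indicator N (R z + x) \<partial>lborel) = emeasure (lborel :: 'b measure) {z. x + R z \<in> N}" .
  qed
  also have "\<dots> = 0"
    using slices by (simp add: null_sets_def)
  finally show ?thesis
    by (auto simp: null_sets_def ennreal_mult_eq_top_iff)
qed

text \<open>For a linear right inverse \<open>R\<close> of \<open>A\<close>,
  \<open>A (x + R z) = A x + z\<close>. So every slice along \<open>R\<close> of the preimage of a
  null set \<open>N\<close> is a translate of \<open>N\<close>, and the preimage is null by the
  previous lemma.\<close>

lemma absolutely_continuous_linear_surj: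
  fixes A :: "'a::euclidean_space \<Rightarrow> 'b::euclidean_space"
  assumes \<mu>: "sets \<mu> = sets borel" "absolutely_continuous lborel \<mu>"
    and A: "linear A" "surj A"
  shows "absolutely_continuous lborel (distr \<mu> borel A)"
  unfolding absolutely_continuous_def
proof
  fix N :: "'b set" assume N: "N \<in> null_sets lborel"
  have mA [measurable]: "A \<in> borel_measurable borel"
    using A by (intro borel_measurable_continuous_onI linear_continuous_on linear_conv_bounded_linear[THEN iffD1])
  have mA' : "A \<in> borel_measurable \<mu>"
    using mA \<mu>(1) measurable_cong_sets by blast
  have [measurable]: "N \<in> sets borel" using N by auto
  obtain R where R: "linear R" "A \<circ> R = id"
    using linear_surjective_right_inverse A by blast
  have AR: "A (R z) = z" for z using R(2) by (metis comp_apply id_apply)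
  have [measurable]: "R \<in> borel_measurable borel"
    using R by (intro borel_measurable_continuous_onI linear_continuous_on linear_conv_bounded_linear[THEN iffD1])
  have m: "A -` N \<in> sets borel"
    using measurable_sets[OF mA \<open>N \<in> sets borel\<close>] by simp
  have "A -` N \<in> null_sets lborel"
  proof (rule null_sets_lborel_if_translates_null[of R])
    fix x
    have "emeasure (lborel :: 'b measure) N = emeasure (distr lborel borel ((+) (A x))) N"
      by (simp add: lborel_distr_plus)
    also have "\<dots> = emeasure lborel {z. A x + z \<in> N}"
      by (subst emeasure_distr) (auto simp: vimage_def)
    also have "{z. A x + z \<in> N} = {z. x + R z \<in> A -` N}"
      using A(1) by (simp add: linear_add AR)
    finally show "{z. x + R z \<in> A -` N} \<in> null_sets lborel"
      using N m by (auto simp: null_sets_def)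
  qed (use m in auto)
  then have "A -` N \<in> null_sets \<mu>"
    using \<mu>(2) by (auto simp: absolutely_continuous_def)
  then have "emeasure (distr \<mu> borel A) N = 0"
    by (subst emeasure_distr[OF mA']) (auto simp: \<mu>(1)[THEN sets_eq_imp_space_eq])
  then show "N \<in> null_sets (distr \<mu> borel A)"
    by (auto simp: null_sets_def)
qed

section \<open>Slopes and second differences of convex functions on the line\<close>

lemma convex_on_secant_le:
  fixes h :: "real \<Rightarrow> real"
  assumes h: "convex_on UNIV h" and le: "x < y" "y \<le> z" "z < w"
  shows "(h y - h x) / (y - x) \<le> (h w - h z) / (w - z)"
proof -
  have 1: "(h y - h x) / (y - x) \<le> (h w - h x) / (w - x)"
    if "x < y" "y < w" for x y w
    using convex_on_slope_le(1)[OF h, of x w y] that by (simp add: field_simps)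
  have 2: "(h w - h x) / (w - x) \<le> (h w - h y) / (w - y)"
    if "x < y" "y < w" for x y w
    using convex_on_slope_le(2)[OF h, of x w y] that by (simp add: field_simps)
  show ?thesis
    using le 1[of x y w] 2[of x y w] 1[of x y z] 2[of x y z] 1[of y z w] 2[of y z w]
    by (cases "y = z") (fastforce intro: order_trans)+
qed

text \<open>The right derivative \<open>R\<close> is monotone, hence continuous off a countable set.
  The second difference divided by \<open>s\<close> is at most \<open>R (t + s) - R (t - s)\<close>,
  which tends to 0 with \<open>s\<close> where \<open>R\<close> is continuous.\<close>

lemma convex_on_second_difference_small:
  fixes h :: "real \<Rightarrow> real"
  assumes h: "convex_on UNIV h"
  shows "countable {t. \<not> (\<forall>k::nat. \<exists>n::nat.
    h (t + 1 / Suc n) + h (t - 1 / Suc n) - 2 * h t < 1 / Suc k * (1 / Suc n))}"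
proof -
  \<comment> \<open>The right derivative: by convexity the quotient decreases as \<open>s\<close>
    decreases to 0, so its limit is the infimum.\<close>
  define R where "R t = Inf ((\<lambda>s. (h (t + s) - h t) / s) ` {0<..})" for t
  note sl = convex_on_secant_le[OF h]
  have bdd: "bdd_below ((\<lambda>s. (h (t + s) - h t) / s) ` {0<..})" for t
    unfolding bdd_below_def
  proof (intro exI ballI)
    fix v assume "v \<in> (\<lambda>s. (h (t + s) - h t) / s) ` {0<..}"
    then obtain s where "s > 0" "v = (h (t + s) - h t) / s" by auto
    then show "h t - h (t - 1) \<le> v" using sl[of "t - 1" t t "t + s"] by simp
  qed
  have Rle: "R t \<le> (h (t + s) - h t) / s" if "s > 0" for t s
    unfolding R_def using that by (intro cInf_lower bdd) auto
  have Rge: "(h t - h (t - s)) / s \<le> R t" if "s > 0" for t s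
    unfolding R_def
  proof (rule cInf_greatest)
    fix v assume "v \<in> (\<lambda>s. (h (t + s) - h t) / s) ` {0<..}"
    then obtain r where "r > 0" "v = (h (t + r) - h t) / r" by auto
    then show "(h t - h (t - s)) / s \<le> v" using sl[of "t - s" t t "t + r"] that by simp
  qed auto
  have "mono R"
  proof (rule monoI)
    fix a b :: real assume "a \<le> b"
    then show "R a \<le> R b"
      using Rle[of "b - a" a] Rge[of "b - a" b] by (cases "a = b") (auto simp: order_trans)
  qed
  then have cont: "countable {t. \<not> isCont R t}" by (rule mono_ctble_discont)
  have small: "\<exists>n::nat. h (t + 1 / Suc n) + h (t - 1 / Suc n) - 2 * h t < 1 / Suc k * (1 / Suc n)"
    if "isCont R t" for t and k :: nat
  proof -
    have "(\<lambda>n. R (t + 1 / Suc n) - R (t - 1 / Suc n)) \<longlonglongrightarrow> R t - R t"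
    proof (intro tendsto_diff isCont_tendsto_compose[OF that])
      show "(\<lambda>n. t + 1 / Suc n) \<longlonglongrightarrow> t" "(\<lambda>n. t - 1 / Suc n) \<longlonglongrightarrow> t"
        using tendsto_add[OF tendsto_const[of t] LIMSEQ_inverse_real_of_nat]
          tendsto_diff[OF tendsto_const[of t] LIMSEQ_inverse_real_of_nat]
        by (auto simp: field_simps)
    qed
    then have "\<forall>\<^sub>F n in sequentially. R (t + 1 / Suc n) - R (t - 1 / Suc n) < 1 / Suc k"
      by (rule order_tendstoD) auto
    then obtain n :: nat where n: "R (t + 1 / Suc n) - R (t - 1 / Suc n) < 1 / Suc k"
      by (auto simp: eventually_sequentially)
    define s :: real where "s = 1 / Suc n"
    have s: "s > 0" unfolding s_def by simp
    have "(h (t + s) - h t) / s \<le> R (t + s)" "R (t - s) \<le> (h t - h (t - s)) / s"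
      using Rge[OF s, of "t + s"] Rle[OF s, of "t - s"] by auto
    then have "(h (t + s) - h t) / s - (h t - h (t - s)) / s < 1 / Suc k"
      using n unfolding s_def by linarith
    then have "h (t + s) + h (t - s) - 2 * h t < 1 / Suc k * s"
      using s by (simp only: diff_divide_distrib[symmetric] pos_divide_less_eq)
    then show ?thesis unfolding s_def by blast
  qed
  show ?thesis
    by (rule countable_subset[OF _ cont]) (use small in blast)
qed

section \<open>Convex functions are differentiable almost everywhere\<close>

lemma convex_on_line:
  fixes u :: "'a::real_vector \<Rightarrow> real"
  assumes "convex_on UNIV u"
  shows "convex_on UNIV (\<lambda>t. u (x + t *\<^sub>R v))"
proof (rule convex_onI)
  fix t a b :: real assume t: "0 < t" "t < 1"
  have "u (x + ((1 - t) *\<^sub>R a + t *\<^sub>R b) *\<^sub>R v) = u ((1 - t) *\<^sub>R (x + a *\<^sub>R v) + t *\<^sub>R (x + b *\<^sub>R v))"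
    by (rule arg_cong[of _ _ u]) (simp add: algebra_simps)
  also have "\<dots> \<le> (1 - t) * u (x + a *\<^sub>R v) + t * u (x + b *\<^sub>R v)"
    using convex_onD[OF assms, of t] t by simp
  finally show "u (x + ((1 - t) *\<^sub>R a + t *\<^sub>R b) *\<^sub>R v) \<le> (1 - t) * u (x + a *\<^sub>R v) + t * u (x + b *\<^sub>R v)" .
qed auto

text \<open>Membership involves only countable quantifiers, so that this set is evidently Borel. For convex
  \<open>u\<close> it is the set of points of differentiability: vanishing second differences along the
  coordinate axes suffice.\<close>

definition smooth_points :: "('a::euclidean_space \<Rightarrow> real) \<Rightarrow> 'a set" where
  "smooth_points u = {x. \<forall>b\<in>Basis. \<forall>k::nat. \<exists>n::nat.
     u (x + (1 / Suc n) *\<^sub>R b) + u (x - (1 / Suc n) *\<^sub>R b) - 2 * u x < 1 / Suc k * (1 / Suc n)}"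

lemma convex_on_borel_measurable:
  fixes u :: "'a::euclidean_space \<Rightarrow> real"
  assumes "convex_on UNIV u"
  shows "u \<in> borel_measurable borel"
  using assms by (intro borel_measurable_continuous_onI convex_on_continuous) auto

lemma smooth_points_borel:
  fixes u :: "'a::euclidean_space \<Rightarrow> real"
  assumes u: "convex_on UNIV u"
  shows "smooth_points u \<in> sets borel"
proof -
  note [measurable] = convex_on_borel_measurable[OF u]
  have "smooth_points u = {x \<in> space borel. \<forall>b\<in>Basis. \<forall>k::nat. \<exists>n::nat.
     u (x + (1 / Suc n) *\<^sub>R b) + u (x - (1 / Suc n) *\<^sub>R b) - 2 * u x < 1 / Suc k * (1 / Suc n)}"
    by (simp add: smooth_points_def)
  also have "\<dots> \<in> sets borel"
    by measurable
  finally show ?thesis .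
qed

text \<open>On each line in direction \<open>b\<close> the bad points are countable by the
  one-dimensional lemma, so the bad set for \<open>b\<close> has null slices and is null. There are
  finitely many axes.\<close>

lemma AE_smooth_points:
  fixes u :: "'a::euclidean_space \<Rightarrow> real"
  assumes u: "convex_on UNIV u"
  shows "AE x in lborel. x \<in> smooth_points u"
proof -
  note [measurable] = convex_on_borel_measurable[OF u]
  define good where "good b = {x \<in> space borel. \<forall>k::nat. \<exists>n::nat.
     u (x + (1 / Suc n) *\<^sub>R b) + u (x - (1 / Suc n) *\<^sub>R b) - 2 * u x < 1 / Suc k * (1 / Suc n)}" for b
  have [measurable]: "good b \<in> sets borel" for b unfolding good_def by measurable
  have "AE x in lborel. x \<in> good b" for b
  proof -
    have "- good b \<in> null_sets lborel"
    proof (rule null_sets_lborel_if_translates_null[of "\<lambda>t. t *\<^sub>R b"])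
      fix x
      have "{t. x + t *\<^sub>R b \<in> - good b} = {t. \<not> (\<forall>k::nat. \<exists>n::nat.
          u (x + (t + 1 / Suc n) *\<^sub>R b) + u (x + (t - 1 / Suc n) *\<^sub>R b) - 2 * u (x + t *\<^sub>R b) < 1 / Suc k * (1 / Suc n))}"
        unfolding good_def by (simp add: algebra_simps)
      then have "countable {t. x + t *\<^sub>R b \<in> - good b}"
        using convex_on_second_difference_small[OF convex_on_line[OF u, of x b]] by simp
      then show "{t. x + t *\<^sub>R b \<in> - good b} \<in> null_sets lborel"
        by (rule countable_imp_null_set_lborel)
    qed (auto intro!: borel_comp)
    from AE_not_in[OF this] show ?thesis by auto
  qed
  then have "AE x in lborel. \<forall>b\<in>Basis. x \<in> good b"
    by (intro AE_finite_allI) auto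
  moreover have "smooth_points u = {x. \<forall>b\<in>Basis. x \<in> good b}"
    by (auto simp: smooth_points_def good_def)
  ultimately show ?thesis by simp
qed

text \<open>The linear part cancels in the second difference. The result shows that outside
  \<open>smooth_points u\<close> there is no gradient, so that \<open>grad u\<close> takes its
  default value there.\<close>

lemma smooth_points_if_differentiable:
  fixes u :: "'a::euclidean_space \<Rightarrow> real"
  assumes "u differentiable (at x)"
  shows "x \<in> smooth_points u"
  unfolding smooth_points_def mem_Collect_eq
proof (intro ballI allI)
  fix b :: 'a and k :: nat
  assume b: "b \<in> Basis"
  obtain u' where "(u has_derivative u') (at x)" using assms by (auto simp: differentiable_def)
  then have lin: "linear u'" and eps: "\<forall>e>0. \<exists>d>0. \<forall>y. norm (y - x) < d \<longrightarrow> norm (u y - u x - u' (y - x)) \<le> e * norm (y - x)"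
    by (auto simp: has_derivative_at_alt bounded_linear.linear)
  \<comment> \<open>The two one-sided errors add up to 2/3 of the target, which leaves room for the
    strict inequality.\<close>
  obtain d where d: "d > 0"
    "\<And>y. norm (y - x) < d \<Longrightarrow> norm (u y - u x - u' (y - x)) \<le> (1 / (3 * Suc k)) * norm (y - x)"
    using eps[rule_format, of "1 / (3 * Suc k)"] by auto
  obtain n where n: "1 / real (Suc n) < d"
    using d(1) nat_approx_posE by blast
  define s :: real where "s = 1 / Suc n"
  have s: "s > 0" "s < d" using n by (auto simp: s_def)
  have "u (x + s *\<^sub>R b) - u x - u' (s *\<^sub>R b) \<le> 1 / (3 * Suc k) * s"
    using d(2)[of "x + s *\<^sub>R b"] s b by simp
  moreover have "u (x - s *\<^sub>R b) - u x + u' (s *\<^sub>R b) \<le> 1 / (3 * Suc k) * s"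
    using d(2)[of "x - s *\<^sub>R b"] s b lin by (simp add: linear_neg)
  moreover have "2 * (1 / (3 * Suc k) * s) < 1 / Suc k * s"
    using s(1) by (simp add: field_simps add_pos_nonneg)
  ultimately have "u (x + s *\<^sub>R b) + u (x - s *\<^sub>R b) - 2 * u x < 1 / Suc k * s"
    by linarith
  then show "\<exists>n::nat. u (x + (1 / Suc n) *\<^sub>R b) + u (x - (1 / Suc n) *\<^sub>R b) - 2 * u x < 1 / Suc k * (1 / Suc n)"
    unfolding s_def by blast
qed

text \<open>Let \<open>g\<close> be the infimum of the right slopes at 0; left slopes lie below it.
  The excesses of \<open>h\<close> over the affine function with slope \<open>g\<close> at
  \<open>s\<close> and \<open>- s\<close> are then nonnegative, so each is at most their sum, the
  second difference. Convexity scales the bound down to smaller \<open>t\<close>.\<close>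

lemma convex_on_one_sided_affine_bound:
  fixes h :: "real \<Rightarrow> real"
  assumes h: "convex_on UNIV h"
    and small: "\<And>k::nat. \<exists>n::nat. h (1 / Suc n) + h (- (1 / Suc n)) - 2 * h 0 < 1 / Suc k * (1 / Suc n)"
  shows "\<exists>g. \<forall>e>0. \<exists>s>0. \<forall>t. \<bar>t\<bar> \<le> s \<longrightarrow> h t - h 0 - t * g \<le> e * \<bar>t\<bar>"
proof -
  define g where "g = Inf ((\<lambda>s. (h s - h 0) / s) ` {0<..})"
  have low: "(h 0 - h (- s)) / s \<le> (h r - h 0) / r" if "s > 0" "r > 0" for s r
    using convex_on_secant_le[OF h, of "- s" 0 0 r] that by simp
  have gle: "g \<le> (h s - h 0) / s" if "s > 0" for s
    unfolding g_def using that low[of 1]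
    by (intro cInf_lower bdd_belowI2[where m = "(h 0 - h (-1)) / 1"]) auto
  have gge: "(h 0 - h (- s)) / s \<le> g" if "s > 0" for s
    unfolding g_def using that by (intro cInf_greatest) (auto intro: low)
  show ?thesis
  proof (rule exI[of _ g], intro allI impI)
    fix e :: real assume "e > 0"
    then obtain k where k: "1 / real (Suc k) < e" using nat_approx_posE by blast
    obtain n :: nat where n: "h (1 / Suc n) + h (- (1 / Suc n)) - 2 * h 0 < 1 / Suc k * (1 / Suc n)"
      using small by blast
    define s :: real where "s = 1 / Suc n"
    have s: "s > 0" by (simp add: s_def)
    have "1 / Suc k * s \<le> e * s" using k s by (intro mult_right_mono) auto
    then have D: "h s + h (- s) - 2 * h 0 \<le> e * s" using n unfolding s_def[symmetric] by linarith
    have p1: "h s - h 0 - s * g \<le> e * s" and p2: "h (- s) - h 0 + s * g \<le> e * s"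
      using gle[OF s] gge[OF s] D s by (auto simp: field_simps)
    have "h t - h 0 - t * g \<le> e * \<bar>t\<bar>" if t: "\<bar>t\<bar> \<le> s" for t
    proof -
      define r where "r = \<bar>t\<bar> / s"
      have r: "0 \<le> r" "r \<le> 1" using t s by (auto simp: r_def)
      define q where "q = (if t \<ge> 0 then s else - s)"
      have q: "h q - h 0 - q * g \<le> e * s" using p1 p2 by (auto simp: q_def)
      have tq: "t = r * q" using s by (auto simp: r_def q_def)
      have "h ((1 - r) *\<^sub>R 0 + r *\<^sub>R q) \<le> (1 - r) * h 0 + r * h q"
        by (rule convex_onD[OF h]) (use r in auto)
      then have "h t - h 0 - t * g \<le> r * (h q - h 0 - q * g)"
        by (simp add: tq algebra_simps)
      also have "\<dots> \<le> r * (e * s)" using q r by (intro mult_left_mono) auto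
      also have "\<dots> = e * \<bar>t\<bar>" using s by (simp add: r_def)
      finally show ?thesis .
    qed
    then show "\<exists>s>0. \<forall>t. \<bar>t\<bar> \<le> s \<longrightarrow> h t - h 0 - t * g \<le> e * \<bar>t\<bar>" using s by blast
  qed
qed

text \<open>The partial derivatives form a candidate \<open>G\<close>; the remainder
  \<open>\<phi>\<close> is convex and small from above along the axes. Jensen's inequality spreads
  the upper bound to all directions, and the lower bound follows from the upper bound at
  \<open>- v\<close>, since \<open>\<phi> v + \<phi> (- v)\<close> is at least
  \<open>2 * \<phi> 0 = 0\<close>.\<close>

lemma GDERIV_if_smooth_point:
  fixes u :: "'a::euclidean_space \<Rightarrow> real"
  assumes u: "convex_on UNIV u" and x: "x \<in> smooth_points u"
  shows "\<exists>g. GDERIV u x :> g"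
proof -
  have "\<forall>b\<in>Basis. \<exists>g. \<forall>e>0. \<exists>s>0. \<forall>t. \<bar>t\<bar> \<le> s \<longrightarrow> u (x + t *\<^sub>R b) - u x - t * g \<le> e * \<bar>t\<bar>"
  proof
    fix b :: 'a assume b: "b \<in> Basis"
    show "\<exists>g. \<forall>e>0. \<exists>s>0. \<forall>t. \<bar>t\<bar> \<le> s \<longrightarrow> u (x + t *\<^sub>R b) - u x - t * g \<le> e * \<bar>t\<bar>"
      using convex_on_one_sided_affine_bound[OF convex_on_line[OF u, of x b]] x b
      by (simp add: smooth_points_def)
  qed
  then obtain g where g: "\<And>b e. b \<in> Basis \<Longrightarrow> e > 0 \<Longrightarrow>
      \<exists>s>0. \<forall>t. \<bar>t\<bar> \<le> s \<longrightarrow> u (x + t *\<^sub>R b) - u x - t * g b \<le> e * \<bar>t\<bar>"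
    by metis
  define G where "G = (\<Sum>b\<in>Basis. g b *\<^sub>R b)"
  have Gb: "G \<bullet> b = g b" if "b \<in> Basis" for b
    unfolding G_def using that by simp
  define \<phi> where "\<phi> v = u (x + v) - u x - v \<bullet> G" for v
  define N where "N = real DIM('a)"
  have N: "N > 0" by (simp add: N_def)
  have cvx: "convex_on UNIV \<phi>"
  proof (rule convex_onI)
    fix t :: real and a b :: 'a assume t: "0 < t" "t < 1"
    have "u (x + ((1 - t) *\<^sub>R a + t *\<^sub>R b)) = u ((1 - t) *\<^sub>R (x + a) + t *\<^sub>R (x + b))"
      by (rule arg_cong[of _ _ u]) (simp add: algebra_simps)
    also have "\<dots> \<le> (1 - t) * u (x + a) + t * u (x + b)"
      using convex_onD[OF u, of t] t by simp
    finally show "\<phi> ((1 - t) *\<^sub>R a + t *\<^sub>R b) \<le> (1 - t) * \<phi> a + t * \<phi> b"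
      by (simp add: \<phi>_def algebra_simps)
  qed auto
  have \<phi>0: "\<phi> 0 = 0" by (simp add: \<phi>_def)
  have upper: "\<exists>d>0. \<forall>v. norm v < d \<longrightarrow> \<phi> v \<le> e * norm v" if e: "e > 0" for e
  proof -
    have "\<forall>b\<in>Basis. \<exists>s>0. \<forall>t. \<bar>t\<bar> \<le> s \<longrightarrow> \<phi> (t *\<^sub>R b) \<le> (e / N) * \<bar>t\<bar>"
      using g[of _ "e / N"] e N by (simp add: \<phi>_def Gb[unfolded inner_commute[of G]])
    then obtain s where s: "\<And>b. b \<in> Basis \<Longrightarrow> s b > 0"
      "\<And>b t. b \<in> Basis \<Longrightarrow> \<bar>t\<bar> \<le> s b \<Longrightarrow> \<phi> (t *\<^sub>R b) \<le> (e / N) * \<bar>t\<bar>"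
      by metis
    \<comment> \<open>Jensen evaluates \<open>\<phi>\<close> at axis points up to \<open>N\<close>
      times as long as \<open>v\<close>; hence the division by \<open>N\<close>.\<close>
    define d where "d = Min (s ` Basis) / N"
    have "d > 0" using s N by (simp add: d_def)
    moreover have "\<phi> v \<le> e * norm v" if v: "norm v < d" for v
    proof -
      have "\<phi> ((N * (v \<bullet> b)) *\<^sub>R b) \<le> e * norm v" if b: "b \<in> Basis" for b
      proof -
        have "\<bar>N * (v \<bullet> b)\<bar> \<le> N * norm v"
          using Basis_le_norm[OF b, of v] N by (simp add: abs_mult)
        also have "\<dots> \<le> N * d" using v N by simp
        also have "\<dots> \<le> s b" using N b by (simp add: d_def)
        finally have "\<phi> ((N * (v \<bullet> b)) *\<^sub>R b) \<le> (e / N) * \<bar>N * (v \<bullet> b)\<bar>"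
          using s(2)[OF b] by blast
        also have "\<dots> = e * \<bar>v \<bullet> b\<bar>" using N by (simp add: abs_mult)
        also have "\<dots> \<le> e * norm v" using Basis_le_norm[OF b, of v] e by simp
        finally show ?thesis .
      qed
      note bound = this
      \<comment> \<open>\<open>v\<close> is the mean of its axis components, each stretched by
        \<open>N\<close>.\<close>
      have "\<phi> v = \<phi> (\<Sum>b\<in>Basis. (1 / N) *\<^sub>R ((N * (v \<bullet> b)) *\<^sub>R b))"
        using N by (simp add: euclidean_representation)
      also have "\<dots> \<le> (\<Sum>b\<in>Basis. (1 / N) * \<phi> ((N * (v \<bullet> b)) *\<^sub>R b))"
        by (rule convex_on_sum[OF _ _ cvx]) (use N in \<open>auto simp: N_def\<close>)
      also have "\<dots> \<le> (\<Sum>b\<in>(Basis::'a set). (1 / N) * (e * norm v))"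
        using N bound by (intro sum_mono mult_left_mono) auto
      also have "\<dots> = e * norm v" using N by (simp add: N_def)
      finally show ?thesis .
    qed
    ultimately show ?thesis by blast
  qed
  have "GDERIV u x :> G"
    unfolding gderiv_def has_derivative_at_alt
  proof (intro conjI allI impI)
    fix e :: real assume "e > 0"
    then obtain d where d: "d > 0" "\<And>v. norm v < d \<Longrightarrow> \<phi> v \<le> e * norm v"
      using upper by blast
    have "norm (u y - u x - (y - x) \<bullet> G) \<le> e * norm (y - x)" if y: "norm (y - x) < d" for y
    proof -
      have "\<phi> ((1 - 1/2) *\<^sub>R (y - x) + (1/2) *\<^sub>R (x - y)) \<le> (1 - 1/2) * \<phi> (y - x) + (1/2) * \<phi> (x - y)"
        by (rule convex_onD[OF cvx]) auto
      moreover have "(1 - 1/2) *\<^sub>R (y - x) + (1/2) *\<^sub>R (x - y) = 0"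
        by (simp add: algebra_simps)
      ultimately have "- \<phi> (x - y) \<le> \<phi> (y - x)" using \<phi>0 by simp
      then have "\<bar>\<phi> (y - x)\<bar> \<le> e * norm (y - x)"
        using d(2)[of "y - x"] d(2)[of "x - y"] y by (simp add: norm_minus_commute)
      then show ?thesis by (simp add: \<phi>_def)
    qed
    then show "\<exists>d>0. \<forall>y. norm (y - x) < d \<longrightarrow> norm (u y - u x - (y - x) \<bullet> G) \<le> e * norm (y - x)"
      using d(1) by blast
  qed (rule bounded_linear_inner_left)
  then show ?thesis by blast
qed

section \<open>Gradients of convex functions: uniqueness, supporting planes, measurability\<close>

lemma grad_eqI:
  assumes "GDERIV u x :> g"
  shows "grad u x = g"
  unfolding grad_def
proof (rule the_equality)
  show "GDERIV u x :> g" by (rule assms)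
  fix g' assume "GDERIV u x :> g'"
  then have "(\<lambda>h. h \<bullet> g') = (\<lambda>h. h \<bullet> g)"
    using assms unfolding gderiv_def by (rule has_derivative_unique)
  then show "g' = g"
    by (metis vector_eq_ldot)
qed

lemma differentiable_if_GDERIV: "GDERIV u x :> g \<Longrightarrow> u differentiable (at x)"
  unfolding gderiv_def differentiable_def by blast

lemma GDERIV_grad:
  assumes "convex_on UNIV u" "x \<in> smooth_points u"
  shows "GDERIV u x :> grad u x"
  using GDERIV_if_smooth_point[OF assms] grad_eqI by metis

lemma GDERIV_line:
  assumes "GDERIV u x :> g"
  shows "((\<lambda>t. u (x + t *\<^sub>R v)) has_field_derivative (g \<bullet> v)) (at 0)"
proof -
  have "((\<lambda>t. u (x + t *\<^sub>R v)) has_derivative (\<lambda>t. (t *\<^sub>R v) \<bullet> g)) (at 0)"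
    using assms unfolding gderiv_def
    by (intro has_derivative_compose[where g = u and f = "\<lambda>t. x + t *\<^sub>R v" and x = 0, simplified])
       (auto intro!: derivative_eq_intros)
  moreover have "(\<lambda>t. (t *\<^sub>R v) \<bullet> g) = (*) (g \<bullet> v)"
    by (auto simp: fun_eq_iff inner_commute)
  ultimately show ?thesis by (simp add: has_field_derivative_def)
qed

lemma convex_on_above_tangent_plane:
  fixes u :: "'a::euclidean_space \<Rightarrow> real"
  assumes u: "convex_on UNIV u" and g: "GDERIV u x :> g"
  shows "u x + g \<bullet> (z - x) \<le> u z"
proof -
  have d: "((\<lambda>t. u (x + t *\<^sub>R (z - x))) has_field_derivative (g \<bullet> (z - x))) (at 0)"
    by (rule GDERIV_line[OF g])
  have "(g \<bullet> (z - x)) * (1 - 0) \<le> u (x + 1 *\<^sub>R (z - x)) - u (x + 0 *\<^sub>R (z - x))"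
    by (rule convex_on_imp_above_tangent[OF convex_on_line[OF u]]) (use d in auto)
  then show ?thesis by simp
qed

text \<open>At smooth points the coordinates of the gradient are limits of measurable difference
  quotients. Elsewhere no \<open>g\<close> is a gradient, so the description defining
  \<open>grad\<close> collapses to the constant \<open>THE g. False\<close>.\<close>

lemma grad_borel_measurable:
  fixes u :: "'a::euclidean_space \<Rightarrow> real"
  assumes u: "convex_on UNIV u"
  shows "grad u \<in> borel_measurable borel"
proof -
  note [measurable] = convex_on_borel_measurable[OF u] smooth_points_borel[OF u]
  have dir: "(\<lambda>n. Suc n * (u (x + (1 / Suc n) *\<^sub>R b) - u x)) \<longlonglongrightarrow> grad u x \<bullet> b"
    if "x \<in> smooth_points u" for x b
  proof -
    have "((\<lambda>t. u (x + t *\<^sub>R b)) has_field_derivative (grad u x \<bullet> b)) (at 0)"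
      by (rule GDERIV_line[OF GDERIV_grad[OF u that]])
    then have "((\<lambda>t. (u (x + t *\<^sub>R b) - u x) / t) \<longlongrightarrow> grad u x \<bullet> b) (at 0)"
      by (simp add: has_field_derivative_iff)
    moreover have "filterlim (\<lambda>n. 1 / real (Suc n)) (at 0) sequentially"
      using LIMSEQ_inverse_real_of_nat
      by (auto simp: filterlim_at inverse_eq_divide)
    ultimately have "(\<lambda>n. (u (x + (1 / Suc n) *\<^sub>R b) - u x) / (1 / Suc n)) \<longlonglongrightarrow> grad u x \<bullet> b"
      by (rule filterlim_compose)
    then show ?thesis by (simp add: mult.commute)
  qed
  have "grad u = (\<lambda>x. if x \<in> smooth_points u
     then (\<Sum>b\<in>Basis. lim (\<lambda>n. Suc n * (u (x + (1 / Suc n) *\<^sub>R b) - u x)) *\<^sub>R b)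
     else (THE g. False))"
  proof
    fix x
    show "grad u x = (if x \<in> smooth_points u
     then (\<Sum>b\<in>Basis. lim (\<lambda>n. Suc n * (u (x + (1 / Suc n) *\<^sub>R b) - u x)) *\<^sub>R b)
     else (THE g. False))"
    proof (cases "x \<in> smooth_points u")
      case True
      then show ?thesis
        by (simp only: limI[OF dir[OF True]] euclidean_representation if_True)
    next
      case False
      then have "(GDERIV u x :> g) = False" for g
        using smooth_points_if_differentiable differentiable_if_GDERIV by blast
      then show ?thesis using False by (simp add: grad_def)
    qed
  qed
  also have "\<dots> \<in> borel_measurable borel"
    by measurable
  finally show ?thesis .
qed

section \<open>The dual transport problem\<close>

text \<open>The indicator of a nonempty closed set \<open>C\<close> is the limit of the bounded
  continuous functions \<open>max 0 (1 - real n * infdist x C)\<close>, and closed sets are an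
  intersection-stable generator of the Borel sets.\<close>

lemma measure_eqI_continuous:
  fixes M N :: "'a::metric_space measure"
  assumes M: "finite_measure M" "sets M = sets borel"
    and N: "finite_measure N" "sets N = sets borel"
    and eq: "\<And>h :: 'a \<Rightarrow> real. continuous_on UNIV h \<Longrightarrow> (\<And>x. \<bar>h x\<bar> \<le> 1) \<Longrightarrow> (\<integral>x. h x \<partial>M) = (\<integral>x. h x \<partial>N)"
  shows "M = N"
proof -
  have lim: "(\<lambda>n. \<integral>x. max 0 (1 - real n * infdist x C) \<partial>L) \<longlonglongrightarrow> measure L C"
    if L: "finite_measure L" "sets L = sets borel" and C: "closed C" "C \<noteq> {}" for L :: "'a measure" and C
  proof -
    interpret finite_measure L by fact
    have [measurable]: "C \<in> sets L" using C L by auto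
    have "(\<lambda>n. \<integral>x. max 0 (1 - real n * infdist x C) \<partial>L) \<longlonglongrightarrow> (\<integral>x. indicat_real C x \<partial>L)"
    proof (rule integral_dominated_convergence[where w = "\<lambda>_. 1"])
      show "AE x in L. (\<lambda>n. max 0 (1 - real n * infdist x C)) \<longlonglongrightarrow> indicat_real C x"
      proof (rule AE_I2)
        fix x
        show "(\<lambda>n. max 0 (1 - real n * infdist x C)) \<longlonglongrightarrow> indicat_real C x"
        proof (cases "x \<in> C")
          case False
          then have pos: "infdist x C > 0"
            using in_closed_iff_infdist_zero[OF C, of x] infdist_nonneg[of x C] by linarith
          obtain N :: nat where "1 / infdist x C < N" using reals_Archimedean2 by blast
          then have "1 < real N * infdist x C" using pos by (simp add: field_simps)
          then have Nb: "1 \<le> real n * infdist x C" if "n \<ge> N" for n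
            using mult_right_mono[of "real N" "real n" "infdist x C"] pos that by linarith
          then have "\<forall>n\<ge>N. max 0 (1 - real n * infdist x C) = 0"
            by auto
          then show ?thesis using False
            by (intro tendsto_eventually) (auto simp: eventually_sequentially)
        qed auto
      qed
      have "(\<lambda>x. max 0 (1 - real n * infdist x C)) \<in> borel_measurable borel" for n
        by (intro borel_measurable_continuous_onI continuous_intros)
      then show "(\<lambda>x. max 0 (1 - real n * infdist x C)) \<in> borel_measurable L" for n
        using measurable_cong_sets[OF L(2) refl] by blast
    qed (auto simp: infdist_nonneg)
    then show ?thesis by simp
  qed
  have closed_eq: "emeasure M C = emeasure N C" if C: "closed C" for C
  \<comment> \<open>\<open>infdist x {}\<close> is 0 by convention, so the approximation would give
    1 instead of the empty indicator.\<close>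
  proof (cases "C = {}")
    case False
    have "(\<integral>x. max 0 (1 - real n * infdist x C) \<partial>M) = (\<integral>x. max 0 (1 - real n * infdist x C) \<partial>N)" for n
      by (rule eq) (auto intro!: continuous_intros simp: infdist_nonneg)
    then have "measure M C = measure N C"
      using lim[OF M C False] lim[OF N C False] LIMSEQ_unique by auto
    then show ?thesis
      using M(1) N(1) by (simp add: finite_measure.emeasure_eq_measure)
  qed auto
  show ?thesis
  proof (rule measure_eqI_generator_eq[where E = "Collect closed" and \<Omega> = UNIV and A = "\<lambda>_. UNIV"])
    show "Int_stable (Collect closed)" by (auto simp: Int_stable_def)
    show "sets M = sigma_sets UNIV (Collect closed)" "sets N = sigma_sets UNIV (Collect closed)"
      using M(2) N(2) by (auto simp: borel_eq_closed)
    show "emeasure M UNIV \<noteq> \<infinity>" 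
      using finite_measure.emeasure_finite[OF M(1)] by simp
  qed (auto simp: closed_eq)
qed

section \<open>Measures carried by compact sets, and Legendre transforms over such sets\<close>

lemma prob_measure_on_AE:
  assumes "prob_measure_on X \<mu>" "compact X"
  shows "AE x in \<mu>. x \<in> X"
proof -
  interpret prob_space \<mu> using assms by (simp add: prob_measure_on_def)
  have "X \<in> sets \<mu>" "prob X = 1"
    using assms by (auto simp: prob_measure_on_def emeasure_eq_measure borel_compact)
  then show ?thesis by (simp add: AE_in_set_eq_1)
qed

lemma prob_measure_on_integrable:
  fixes f :: "'a::euclidean_space \<Rightarrow> 'b::{banach, second_countable_topology}"
  assumes \<mu>: "prob_measure_on X \<mu>" "compact X" and f: "continuous_on UNIV f"
  shows "integrable \<mu> f"
proof -
  interpret prob_space \<mu> using \<mu> by (simp add: prob_measure_on_def)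
  have "compact (f ` X)"
    using f \<mu>(2) by (intro compact_continuous_image) (auto intro: continuous_on_subset)
  then obtain B where "\<And>x. x \<in> X \<Longrightarrow> norm (f x) \<le> B"
    using compact_imp_bounded bounded_iff by (metis image_eqI)
  moreover have "f \<in> borel_measurable \<mu>"
    using borel_measurable_continuous_onI[OF f] \<mu>(1) measurable_cong_sets[of \<mu> borel borel borel]
    unfolding prob_measure_on_def by blast
  ultimately show ?thesis
    using eventually_mono[OF prob_measure_on_AE[OF \<mu>]] by (intro integrable_const_bound[of _ B]) simp_all
qed

lemma prob_measure_on_nonempty: "prob_measure_on X \<mu> \<Longrightarrow> X \<noteq> {}"
  by (auto simp: prob_measure_on_def)

text \<open>The convex conjugate of \<open>g\<close> set to infinity outside \<open>Y\<close>. For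
  compact nonempty \<open>Y\<close> and continuous \<open>g\<close> the supremum is attained, so the
  transform is finite on the whole space.\<close>

definition legendre :: "'a::euclidean_space set \<Rightarrow> ('a \<Rightarrow> real) \<Rightarrow> 'a \<Rightarrow> real" where
  "legendre Y g x = (SUP y\<in>Y. x \<bullet> y - g y)"

lemma legendre_attained:
  assumes "compact Y" "Y \<noteq> {}" "continuous_on Y g"
  shows "\<exists>y\<in>Y. legendre Y g x = x \<bullet> y - g y"
proof -
  have "continuous_on Y (\<lambda>y. x \<bullet> y - g y)" using assms by (intro continuous_intros)
  then obtain y where "y \<in> Y" "\<forall>z\<in>Y. x \<bullet> z - g z \<le> x \<bullet> y - g y"
    using continuous_attains_sup assms by blast
  then show ?thesis
    unfolding legendre_def by (intro bexI[of _ y] cSup_eq_maximum) auto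
qed

lemma legendre_upper:
  assumes "compact Y" "continuous_on Y g" "y \<in> Y"
  shows "x \<bullet> y - g y \<le> legendre Y g x"
proof -
  have "continuous_on Y (\<lambda>y. x \<bullet> y - g y)" using assms by (intro continuous_intros)
  then have "compact ((\<lambda>y. x \<bullet> y - g y) ` Y)"
    using assms(1) by (rule compact_continuous_image)
  then have "bdd_above ((\<lambda>y. x \<bullet> y - g y) ` Y)"
    by (intro bounded_imp_bdd_above compact_imp_bounded)
  then show ?thesis
    unfolding legendre_def using assms(3) by (intro cSUP_upper)
qed

lemma legendre_mono:
  assumes "compact Y" "Y \<noteq> {}" "continuous_on Y g" "continuous_on Y h"
    and "\<And>y. y \<in> Y \<Longrightarrow> g y \<le> h y + c"
  shows "legendre Y h x \<le> legendre Y g x + c"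
proof -
  obtain y where y: "y \<in> Y" "legendre Y h x = x \<bullet> y - h y"
    using legendre_attained[OF assms(1,2,4)] by blast
  show ?thesis
    using legendre_upper[OF assms(1,3) y(1), of x] assms(5)[OF y(1)] y(2) by linarith
qed

lemma convex_on_legendre:
  assumes Y: "compact Y" "Y \<noteq> {}" "continuous_on Y g"
  shows "convex_on UNIV (legendre Y g)"
proof (rule convex_onI)
  fix t :: real and a b :: 'a assume t: "0 < t" "t < 1"
  obtain y where y: "y \<in> Y" "legendre Y g ((1 - t) *\<^sub>R a + t *\<^sub>R b) = ((1 - t) *\<^sub>R a + t *\<^sub>R b) \<bullet> y - g y"
    using legendre_attained[OF Y] by blast
  have "((1 - t) *\<^sub>R a + t *\<^sub>R b) \<bullet> y - g y = (1 - t) * (a \<bullet> y - g y) + t * (b \<bullet> y - g y)"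
    by (simp add: algebra_simps)
  also have "\<dots> \<le> (1 - t) * legendre Y g a + t * legendre Y g b"
    using t legendre_upper[OF Y(1,3) y(1)] by (intro add_mono mult_left_mono) auto
  finally show "legendre Y g ((1 - t) *\<^sub>R a + t *\<^sub>R b) \<le> (1 - t) * legendre Y g a + t * legendre Y g b"
    using y(2) by simp
qed auto

lemma continuous_on_legendre:
  assumes "compact Y" "Y \<noteq> {}" "continuous_on Y g"
  shows "continuous_on UNIV (legendre Y g)"
  by (rule convex_on_continuous) (auto intro: convex_on_legendre[OF assms])

text \<open>The transform is a maximum of affine functions with slopes in \<open>Y\<close>. The
  constant does not depend on \<open>g\<close>; with \<open>X\<close> in place of \<open>Y\<close>
  this makes all biconjugates equicontinuous.\<close>

lemma legendre_Lipschitz: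
  assumes Y: "compact Y" "Y \<noteq> {}" "continuous_on Y g" and R: "\<And>y. y \<in> Y \<Longrightarrow> norm y \<le> R"
  shows "\<bar>legendre Y g x - legendre Y g x'\<bar> \<le> R * norm (x - x')"
proof -
  have *: "legendre Y g x \<le> legendre Y g x' + R * norm (x - x')" for x x'
  proof -
    obtain y where y: "y \<in> Y" "legendre Y g x = x \<bullet> y - g y"
      using legendre_attained[OF Y] by blast
    have "(x - x') \<bullet> y \<le> norm (x - x') * norm y" by (rule norm_cauchy_schwarz)
    also have "\<dots> \<le> R * norm (x - x')" using R[OF y(1)] by (simp add: mult.commute mult_right_mono)
    finally show ?thesis
      using legendre_upper[OF Y(1,3) y(1), of x'] y(2) by (simp add: inner_diff_left)
  qed
  show ?thesis using *[of x x'] *[of x' x] by (simp add: norm_minus_commute abs_le_iff)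
qed

text \<open>Subtracting from \<open>u\<close> the linear function with slope \<open>y\<close> leaves
  a minimum at \<open>x\<close>. The derivative there in direction \<open>g - y\<close> is the
  squared norm of \<open>g - y\<close>, and it must vanish.\<close>

lemma subgradient_eq_gradient:
  assumes g: "GDERIV u x :> g" and sub: "\<And>z. u x + y \<bullet> (z - x) \<le> u z"
  shows "y = g"
proof -
  have "((\<lambda>t. u (x + t *\<^sub>R (g - y)) - t * (y \<bullet> (g - y))) has_field_derivative (g \<bullet> (g - y) - y \<bullet> (g - y))) (at 0)"
    using GDERIV_line[OF g, of "g - y"] by (auto intro!: derivative_eq_intros)
  moreover have "\<forall>t. \<bar>0 - t\<bar> < 1 \<longrightarrow> u (x + 0 *\<^sub>R (g - y)) - 0 * (y \<bullet> (g - y)) \<le> u (x + t *\<^sub>R (g - y)) - t * (y \<bullet> (g - y))"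
  proof (intro allI impI)
    fix t
    show "u (x + 0 *\<^sub>R (g - y)) - 0 * (y \<bullet> (g - y)) \<le> u (x + t *\<^sub>R (g - y)) - t * (y \<bullet> (g - y))"
      using sub[of "x + t *\<^sub>R (g - y)"] by simp
  qed
  ultimately have "g \<bullet> (g - y) - y \<bullet> (g - y) = 0"
    by (rule DERIV_local_min[OF _ zero_less_one])
  then show ?thesis by (simp flip: inner_diff_left)
qed

text \<open>A maximizer at \<open>x\<close> is a subgradient of the transform at \<open>x\<close>.
  In particular it is unique wherever the transform is differentiable.\<close>

lemma legendre_maximizer_eq_grad:
  assumes Y: "compact Y" "continuous_on Y g" and x: "GDERIV (legendre Y g) x :> G"
    and y: "y \<in> Y" "legendre Y g x = x \<bullet> y - g y"
  shows "y = G"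
proof (rule subgradient_eq_gradient[OF x])
  fix z
  show "legendre Y g x + y \<bullet> (z - x) \<le> legendre Y g z"
    using legendre_upper[OF Y y(1), of z] y(2) by (simp add: algebra_simps inner_commute)
qed

text \<open>Off any ball around \<open>l\<close>, what remains of \<open>Y\<close> is compact, and
  if nonempty \<open>F\<close> has a positive minimum there; values tending to 0 force the sequence
  into the ball.\<close>

lemma tendsto_unique_minimizer:
  fixes y :: "nat \<Rightarrow> 'a::metric_space" and F :: "'a \<Rightarrow> real"
  assumes Y: "compact Y" "continuous_on Y F" and y: "\<And>n. y n \<in> Y"
    and lim: "(\<lambda>n. F (y n)) \<longlonglongrightarrow> 0" and pos: "\<And>z. z \<in> Y \<Longrightarrow> z \<noteq> l \<Longrightarrow> F z > 0"
  shows "y \<longlonglongrightarrow> l"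
proof (rule tendstoI)
  fix e :: real assume e: "e > 0"
  define K where "K = Y \<inter> {z. dist z l \<ge> e}"
  have K: "compact K" unfolding K_def
    using Y by (intro compact_Int_closed closed_Collect_le continuous_intros)
  show "\<forall>\<^sub>F n in sequentially. dist (y n) l < e"
  proof (cases "K = {}")
    case True
    then have "dist (y n) l < e" for n using y[of n] by (auto simp: K_def not_le)
    then show ?thesis by simp
  next
    case False
    moreover have "continuous_on K F" using Y(2) by (rule continuous_on_subset) (auto simp: K_def)
    ultimately obtain z where z: "z \<in> K" "\<And>w. w \<in> K \<Longrightarrow> F z \<le> F w"
      using continuous_attains_inf[OF K] by blast
    have "z \<in> Y" "z \<noteq> l" using z(1) e by (auto simp: K_def)
    then have "F z > 0" by (rule pos)
    then have "\<forall>\<^sub>F n in sequentially. F (y n) < F z"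
      using lim by (auto dest: order_tendstoD)
    then show ?thesis
    proof (rule eventually_mono)
      fix n assume "F (y n) < F z"
      then have "y n \<notin> K" using z(2)[of "y n"] by auto
      then show "dist (y n) l < e" using y[of n] by (auto simp: K_def)
    qed
  qed
qed

section \<open>The dual functional and its minimizer\<close>

locale compactly_supported_pair =
  fixes X Y :: "'a::euclidean_space set" and \<rho> \<nu> :: "'a measure"
  assumes X: "compact X" and Y: "compact Y"
    and \<rho>: "prob_measure_on X \<rho>" and \<nu>: "prob_measure_on Y \<nu>"
begin

lemma nonempty: "X \<noteq> {}" "Y \<noteq> {}"
  using \<rho> \<nu> prob_measure_on_nonempty by auto

sublocale R: prob_space \<rho> using \<rho> by (simp add: prob_measure_on_def)
sublocale N: prob_space \<nu> using \<nu> by (simp add: prob_measure_on_def)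

definition dual_value :: "('a \<Rightarrow> real) \<Rightarrow> real" where
  "dual_value g = (\<integral>y. g y \<partial>\<nu>) + (\<integral>x. legendre Y g x \<partial>\<rho>)"

lemma legendre_integrable:
  assumes "continuous_on UNIV g"
  shows "integrable \<rho> (legendre Y g)" "integrable \<nu> (legendre X g)"
  using assms by (auto intro!: prob_measure_on_integrable[OF \<rho> X] prob_measure_on_integrable[OF \<nu> Y]
      continuous_on_legendre X Y nonempty intro: continuous_on_subset)

text \<open>Comparison with slack. Zero slacks serve the biconjugate, opposite slacks the shift by a
  constant, and slacks \<open>e / 3\<close> the uniform limit of a minimizing sequence.\<close>

lemma dual_value_le:
  assumes g: "continuous_on UNIV g" and h: "continuous_on UNIV h"
    and "\<And>y. y \<in> Y \<Longrightarrow> g y \<le> h y + c" and "\<And>x. x \<in> X \<Longrightarrow> legendre Y g x \<le> legendre Y h x + d"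
  shows "dual_value g \<le> dual_value h + (c + d)"
proof -
  have "(\<integral>y. g y \<partial>\<nu>) \<le> (\<integral>y. h y + c \<partial>\<nu>)"
    using assms
    by (intro integral_mono_AE eventually_mono[OF prob_measure_on_AE[OF \<nu> Y]]
        prob_measure_on_integrable[OF \<nu> Y] continuous_intros) auto
  moreover have "(\<integral>x. legendre Y g x \<partial>\<rho>) \<le> (\<integral>x. legendre Y h x + d \<partial>\<rho>)"
    using assms
    by (intro integral_mono_AE eventually_mono[OF prob_measure_on_AE[OF \<rho> X]]
        Bochner_Integration.integrable_add legendre_integrable) auto
  ultimately show ?thesis
    using prob_measure_on_integrable[OF \<nu> Y h] legendre_integrable(1)[OF h]
    by (simp add: dual_value_def R.prob_space N.prob_space)
qed

text \<open>The biconjugate lies below \<open>g\<close> on \<open>Y\<close>, and its transform lies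
  below \<open>legendre Y g\<close> on \<open>X\<close>; both are Fenchel's inequality read at a
  maximizer.\<close>

lemma dual_value_biconjugate_le:
  assumes g: "continuous_on UNIV g"
  shows "dual_value (legendre X (legendre Y g)) \<le> dual_value g"
proof -
  have gY: "continuous_on Y g" using g continuous_on_subset by blast
  have c1: "continuous_on UNIV (legendre Y g)" by (intro continuous_on_legendre Y nonempty gY)
  then have c1X: "continuous_on X (legendre Y g)" using continuous_on_subset by blast
  have c2: "continuous_on UNIV (legendre X (legendre Y g))"
    by (intro continuous_on_legendre X nonempty c1X)
  then have c2Y: "continuous_on Y (legendre X (legendre Y g))" using continuous_on_subset by blast
  have "dual_value (legendre X (legendre Y g)) \<le> dual_value g + (0 + 0)"
  proof (rule dual_value_le[OF c2 g])
    fix y assume y: "y \<in> Y"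
    obtain x where x: "x \<in> X" "legendre X (legendre Y g) y = y \<bullet> x - legendre Y g x"
      using legendre_attained[OF X nonempty(1) c1X] by blast
    show "legendre X (legendre Y g) y \<le> g y + 0"
      using legendre_upper[OF Y gY y, of x] x(2) by (simp add: inner_commute)
  next
    fix x assume x: "x \<in> X"
    obtain y where y: "y \<in> Y" "legendre Y (legendre X (legendre Y g)) x = x \<bullet> y - legendre X (legendre Y g) y"
      using legendre_attained[OF Y nonempty(2) c2Y] by blast
    show "legendre Y (legendre X (legendre Y g)) x \<le> legendre Y g x + 0"
      using legendre_upper[OF X c1X x, of y] y(2) by (simp add: inner_commute)
  qed
  then show ?thesis by simp
qed

text \<open>Subtracting a constant from \<open>g\<close> adds it to the transform, and both measures
  have mass 1. So competitors can be normalized to vanish at a given point.\<close>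

lemma dual_value_shift_le:
  assumes g: "continuous_on UNIV g"
  shows "dual_value (\<lambda>y. g y - c) \<le> dual_value g"
proof -
  have gY: "continuous_on Y g" using g continuous_on_subset by blast
  have "dual_value (\<lambda>y. g y - c) \<le> dual_value g + (- c + c)"
  proof (rule dual_value_le)
    show "legendre Y (\<lambda>y. g y - c) x \<le> legendre Y g x + c" for x
      by (rule legendre_mono[OF Y nonempty(2)]) (auto intro!: continuous_intros gY)
  qed (auto intro!: continuous_intros g)
  then show ?thesis by simp
qed

text \<open>Replacing a competitor by its biconjugate makes it Lipschitz with a constant depending only
  on the supports, so a minimizing sequence has a uniformly convergent subsequence.\<close>

lemma dual_minimizer_exists:
  "\<exists>g. continuous_on UNIV g \<and> (\<forall>h. continuous_on UNIV h \<longrightarrow> dual_value g \<le> dual_value h)"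
proof -
  obtain L where L: "\<And>x. x \<in> X \<Longrightarrow> norm x \<le> L" "L > 0"
    using compact_imp_bounded[OF X] bounded_pos by metis
  obtain D where D: "\<And>y. y \<in> Y \<Longrightarrow> norm y \<le> D" "D > 0"
    using compact_imp_bounded[OF Y] bounded_pos by metis
  obtain y0 where y0: "y0 \<in> Y" using nonempty by blast
  \<comment> \<open>The normalized competitors. \<open>L\<close> bounds the norms on
    \<open>X\<close>, hence the slopes of any transform over \<open>X\<close>.\<close>
  define \<F> where "\<F> = {g :: 'a \<Rightarrow> real. (\<forall>x y. \<bar>g x - g y\<bar> \<le> L * norm (x - y)) \<and> g y0 = 0}"
  have cont: "continuous_on UNIV g" if "g \<in> \<F>" for g
  proof -
    have "L-lipschitz_on UNIV g"
      using that L(2) by (auto simp: \<F>_def lipschitz_on_def dist_norm)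
    then show ?thesis by (rule lipschitz_on_continuous_on)
  qed
  have bnd: "\<bar>g y\<bar> \<le> L * (2 * D)" if "g \<in> \<F>" "y \<in> Y" for g y
  proof -
    have "\<bar>g y\<bar> \<le> L * norm (y - y0)"
      using that(1) unfolding \<F>_def mem_Collect_eq by (metis diff_zero)
    also have "norm (y - y0) \<le> 2 * D"
      using norm_triangle_ineq4[of y y0] D(1)[OF that(2)] D(1)[OF y0] by linarith
    finally show ?thesis using L(2) by simp
  qed
  have reduce: "\<exists>g\<in>\<F>. dual_value g \<le> dual_value h" if h: "continuous_on UNIV h" for h
  proof -
    define k where "k = legendre X (legendre Y h)"
    have hX: "continuous_on X (legendre Y h)"
      using continuous_on_legendre[OF Y nonempty(2), of h] h continuous_on_subset by blast
    have k: "continuous_on UNIV k" unfolding k_def by (intro continuous_on_legendre X nonempty hX)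
    have "(\<lambda>y. k y - k y0) \<in> \<F>"
      using legendre_Lipschitz[OF X nonempty(1) hX L(1)] by (simp add: \<F>_def k_def)
    moreover have "dual_value (\<lambda>y. k y - k y0) \<le> dual_value h"
      using dual_value_shift_le[OF k] dual_value_biconjugate_le[OF h] unfolding k_def
      by (rule order_trans)
    ultimately show ?thesis by blast
  qed
  \<comment> \<open>The first term bounds \<open>g\<close> on \<open>Y\<close>. The second bounds
    the transform at \<open>x\<close> through its value \<open>x \<bullet> y0\<close> at the point
    \<open>y0\<close>, where \<open>g\<close> vanishes.\<close>
  have lower: "- (L * (2 * D)) + - (L * D) \<le> dual_value g" if g: "g \<in> \<F>" for g
  proof -
    note gc = cont[OF g]
    have gY: "continuous_on Y g" using gc continuous_on_subset by blast
    have "(\<integral>y. - (L * (2 * D)) \<partial>\<nu>) \<le> (\<integral>y. g y \<partial>\<nu>)"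
    proof (intro integral_mono_AE prob_measure_on_integrable[OF \<nu> Y] gc continuous_on_const
        eventually_mono[OF prob_measure_on_AE[OF \<nu> Y]])
      show "- (L * (2 * D)) \<le> g y" if "y \<in> Y" for y
        using bnd[OF g that] by linarith
    qed
    moreover have "(\<integral>x. - (L * D) \<partial>\<rho>) \<le> (\<integral>x. legendre Y g x \<partial>\<rho>)"
    proof (intro integral_mono_AE legendre_integrable(1)[OF gc])
      have "- (L * D) \<le> legendre Y g x" if x: "x \<in> X" for x
      proof -
        have "\<bar>x \<bullet> y0\<bar> \<le> norm x * norm y0" by (rule Cauchy_Schwarz_ineq2)
        also have "\<dots> \<le> L * D" using L D(1)[OF y0] x by (intro mult_mono) auto
        finally show ?thesis
          using legendre_upper[OF Y gY y0, of x] g by (simp add: \<F>_def)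
      qed
      then show "AE x in \<rho>. - (L * D) \<le> legendre Y g x"
        by (rule eventually_mono[OF prob_measure_on_AE[OF \<rho> X]])
    qed auto
    ultimately show ?thesis
      unfolding dual_value_def by (simp only: lebesgue_integral_const R.prob_space N.prob_space scaleR_one add_mono)
  qed
  define m where "m = Inf (dual_value ` \<F>)"
  have bdd: "bdd_below (dual_value ` \<F>)" by (rule bdd_belowI2[OF lower])
  have "\<F> \<noteq> {}" using reduce[of "\<lambda>_. 0"] by auto
  have "\<exists>g\<in>\<F>. dual_value g < m + 1 / Suc n" for n :: nat
    using cInf_lessD[of "dual_value ` \<F>" "m + 1 / Suc n"] \<open>\<F> \<noteq> {}\<close> by (auto simp: m_def)
  then obtain F where F: "\<And>n::nat. F n \<in> \<F>" "\<And>n. dual_value (F n) < m + 1 / Suc n"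
    by metis
  obtain g0 k where g0: "continuous_on Y g0" and k: "strict_mono (k :: nat \<Rightarrow> nat)"
    and unif: "\<And>e. 0 < e \<Longrightarrow> \<exists>N. \<forall>n x. n \<ge> N \<and> x \<in> Y \<longrightarrow> norm (F (k n) x - g0 x) < e"
  proof (rule Arzela_Ascoli[OF Y, of F "L * (2 * D)"])
    show "norm (F n x) \<le> L * (2 * D)" if "x \<in> Y" for n x
      using bnd[OF F(1) that] by simp
    show "\<exists>d. 0 < d \<and> (\<forall>n y. y \<in> Y \<and> norm (x - y) < d \<longrightarrow> norm (F n x - F n y) < e)"
      if "x \<in> Y" "0 < e" for x e
    proof (intro exI[of _ "e / L"] conjI allI impI)
      fix n y assume "y \<in> Y \<and> norm (x - y) < e / L"
      then have "L * norm (x - y) < e" using L(2) by (simp add: field_simps)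
      moreover have "\<bar>F n x - F n y\<bar> \<le> L * norm (x - y)" using F(1)[of n] by (auto simp: \<F>_def)
      ultimately show "norm (F n x - F n y) < e" by simp
    qed (use that L in auto)
  qed blast
  \<comment> \<open>The uniform limit is known on \<open>Y\<close> only. Tietze extends it to the
    whole space, and \<open>dual_value\<close> sees only the values on \<open>Y\<close>.\<close>
  obtain g where g: "continuous_on UNIV g" "\<And>y. y \<in> Y \<Longrightarrow> g y = g0 y"
    using Tietze_unbounded[OF g0, of UNIV] compact_imp_closed[OF Y] by auto
  have gY: "continuous_on Y g" using g(1) continuous_on_subset by blast
  have "dual_value g \<le> m"
  proof (rule field_le_epsilon)
    fix e :: real assume e: "e > 0"
    obtain N where N: "\<And>n y. n \<ge> N \<Longrightarrow> y \<in> Y \<Longrightarrow> norm (F (k n) y - g0 y) < e / 3"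
      using unif[of "e / 3"] e by auto
    obtain M where M: "1 / real (Suc M) < e / 3" using nat_approx_posE[of "e/3"] e by auto
    define n where "n = max N M"
    have "1 / real (Suc (k n)) \<le> 1 / real (Suc M)"
      using seq_suble[OF k, of n] by (intro divide_left_mono) (auto simp: n_def)
    then have dF: "dual_value (F (k n)) < m + e / 3" using F(2)[of "k n"] M by linarith
    have close: "\<bar>F (k n) y - g y\<bar> \<le> e / 3" if "y \<in> Y" for y
      using N[of n y] that g(2) by (simp add: n_def)
    have FY: "continuous_on Y (F (k n))" using cont[OF F(1)] continuous_on_subset by blast
    have "dual_value g \<le> dual_value (F (k n)) + (e / 3 + e / 3)"
    proof (rule dual_value_le[OF g(1) cont[OF F(1)]])
      show "g y \<le> F (k n) y + e / 3" if "y \<in> Y" for y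
        using close[OF that] by linarith
      have "F (k n) y \<le> g y + e / 3" if "y \<in> Y" for y
        using close[OF that] by linarith
      then show "legendre Y g x \<le> legendre Y (F (k n)) x + e / 3" for x
        by (rule legendre_mono[OF Y nonempty(2) FY gY])
    qed
    then show "dual_value g \<le> m + e" using dF by linarith
  qed
  moreover have "m \<le> dual_value h" if h: "continuous_on UNIV h" for h
  proof -
    obtain h' where h': "h' \<in> \<F>" "dual_value h' \<le> dual_value h" using reduce[OF h] by blast
    have "m \<le> dual_value h'" unfolding m_def using h'(1) bdd by (intro cInf_lower) auto
    then show ?thesis using h'(2) by linarith
  qed
  ultimately show ?thesis using g(1) order_trans by blast
qed

end

section \<open>Brenier's theorem\<close>

text \<open>Envelope theorem: perturbing \<open>g\<close> to \<open>g + \<epsilon> h\<close> changes the maximum defining the Legendre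
  transform at \<open>x\<close> by \<open>- \<epsilon> h\<close> at the maximizer, to first order.\<close>

lemma legendre_perturbation:
  assumes Y: "compact Y" "Y \<noteq> {}" and g: "continuous_on Y g" and h: "continuous_on Y h"
    and B: "\<And>y. y \<in> Y \<Longrightarrow> \<bar>h y\<bar> \<le> B"
    and G: "GDERIV (legendre Y g) x :> G"
  shows "G \<in> Y"
    and "(\<lambda>n. Suc n * (legendre Y (\<lambda>y. g y + (1 / Suc n) * h y) x - legendre Y g x)) \<longlonglongrightarrow> - h G"
    and "\<bar>Suc n * (legendre Y (\<lambda>y. g y + (1 / Suc n) * h y) x - legendre Y g x)\<bar> \<le> B"
proof -
  obtain y0 where y0: "y0 \<in> Y" "legendre Y g x = x \<bullet> y0 - g y0"
    using legendre_attained[OF Y g] by blast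
  have y0G: "y0 = G" by (rule legendre_maximizer_eq_grad[OF Y(1) g G y0])
  show GY: "G \<in> Y" using y0(1) y0G by simp
  have gh: "continuous_on Y (\<lambda>y. g y + (1 / Suc n) * h y)" for n :: nat
    using g h by (intro continuous_intros)
  have "\<forall>n. \<exists>y\<in>Y. legendre Y (\<lambda>y. g y + (1 / Suc n) * h y) x = x \<bullet> y - (g y + (1 / Suc n) * h y)"
    using legendre_attained[OF Y gh] by blast
  then obtain y where y: "\<And>n. y n \<in> Y"
    "\<And>n. legendre Y (\<lambda>y. g y + (1 / Suc n) * h y) x = x \<bullet> y n - (g (y n) + (1 / Suc n) * h (y n))"
    by metis
  define D where "D n = legendre Y (\<lambda>y. g y + (1 / Suc n) * h y) x - legendre Y g x" for n :: nat
  \<comment> \<open>Lower bound: try the old maximizer \<open>G\<close> in the perturbed problem.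
    Upper bound: try the perturbed maximizer \<open>y n\<close> in the old problem.\<close>
  have lo: "- (1 / Suc n) * h G \<le> D n" for n
    using legendre_upper[OF Y(1) gh[of n] GY, of x] y0 y0G by (simp add: D_def)
  have up: "D n \<le> - (1 / Suc n) * h (y n)" for n
    using legendre_upper[OF Y(1) g y(1)[of n], of x] y(2)[of n] by (simp add: D_def)
  have lo': "- h G \<le> Suc n * D n" for n
    using mult_left_mono[OF lo[of n], of "Suc n"] by (simp del: of_nat_Suc)
  have up': "Suc n * D n \<le> - h (y n)" for n
    using mult_left_mono[OF up[of n], of "Suc n"] by (simp del: of_nat_Suc)
  \<comment> \<open>The optimality gap in the unperturbed problem. It is of order
    \<open>1 / Suc n\<close> at \<open>y n\<close> and is positive on \<open>Y\<close> away from
    \<open>G\<close>, so \<open>y\<close> tends to \<open>G\<close>.\<close>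
  define F where "F z = legendre Y g x - (x \<bullet> z - g z)" for z
  have Fc: "continuous_on Y F" unfolding F_def using g by (intro continuous_intros)
  have "F (y n) \<le> (1 / Suc n) * (2 * B)" for n
  proof -
    have "F (y n) = - D n - (1 / Suc n) * h (y n)"
      using y(2)[of n] by (simp add: F_def D_def)
    also have "\<dots> \<le> (1 / Suc n) * (h G - h (y n))"
      using lo[of n] by (simp add: algebra_simps diff_divide_distrib)
    also have "\<dots> \<le> (1 / Suc n) * (2 * B)"
      using B[OF GY] B[OF y(1)[of n]] by (intro mult_left_mono) auto
    finally show ?thesis .
  qed
  moreover have "0 \<le> F (y n)" for n
    using legendre_upper[OF Y(1) g y(1)[of n], of x] by (simp add: F_def)
  moreover have "(\<lambda>n. (1 / Suc n) * (2 * B)) \<longlonglongrightarrow> 0 * (2 * B)"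
    using LIMSEQ_inverse_real_of_nat by (intro tendsto_mult tendsto_const) (simp add: inverse_eq_divide)
  ultimately have "(\<lambda>n. F (y n)) \<longlonglongrightarrow> 0"
    by (intro tendsto_sandwich[OF _ _ tendsto_const, of 0 "\<lambda>n. F (y n)" sequentially "\<lambda>n. (1 / Suc n) * (2 * B)"]) auto
  then have "y \<longlonglongrightarrow> G"
  proof (rule tendsto_unique_minimizer[OF Y(1) Fc y(1)])
    fix z assume z: "z \<in> Y" "z \<noteq> G"
    then have "legendre Y g x \<noteq> x \<bullet> z - g z"
      using legendre_maximizer_eq_grad[OF Y(1) g G] by blast
    then show "F z > 0"
      using legendre_upper[OF Y(1) g z(1), of x] by (simp add: F_def)
  qed
  then have "(\<lambda>n. - h (y n)) \<longlonglongrightarrow> - h G"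
    using h GY y(1) by (intro tendsto_minus continuous_on_tendsto_compose[OF h]) auto
  then have "(\<lambda>n. Suc n * D n) \<longlonglongrightarrow> - h G"
    using lo' up' by (intro tendsto_sandwich[OF _ _ tendsto_const, of "- h G" "\<lambda>n. Suc n * D n" sequentially "\<lambda>n. - h (y n)"]) auto
  then show "(\<lambda>n. Suc n * (legendre Y (\<lambda>y. g y + (1 / Suc n) * h y) x - legendre Y g x)) \<longlonglongrightarrow> - h G"
    by (simp add: D_def)
  show "\<bar>Suc n * (legendre Y (\<lambda>y. g y + (1 / Suc n) * h y) x - legendre Y g x)\<bar> \<le> B"
    using lo'[of n] up'[of n] B[OF GY] B[OF y(1)[of n]] unfolding D_def[symmetric] by linarith
qed

section \<open>First variation of the dual functional and existence of the map\<close>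

context compactly_supported_pair
begin

text \<open>Compare \<open>g\<close> with \<open>g + h / Suc n\<close>: by minimality, the
  difference quotients of the transform have integral at least minus that of \<open>h\<close>. They
  converge almost everywhere to \<open>- h (grad u x)\<close> and are bounded by \<open>B\<close>,
  so dominated convergence applies.\<close>

lemma minimizer_first_variation:
  fixes h :: "'a \<Rightarrow> real"
  assumes g: "continuous_on UNIV g" "\<And>h. continuous_on UNIV h \<Longrightarrow> dual_value g \<le> dual_value h"
    and smooth: "AE x in \<rho>. x \<in> smooth_points (legendre Y g)"
    and h: "continuous_on UNIV h"
  shows "(\<integral>x. h (grad (legendre Y g) x) \<partial>\<rho>) \<le> (\<integral>y. h y \<partial>\<nu>)"
proof -
  have gY: "continuous_on Y g" and hY: "continuous_on Y h"
    using g h continuous_on_subset by blast+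
  define u where "u = legendre Y g"
  define v where "v n = legendre Y (\<lambda>y. g y + (1 / Suc n) * h y)" for n :: nat
  have u: "convex_on UNIV u" unfolding u_def by (intro convex_on_legendre Y nonempty gY)
  have ghn: "continuous_on UNIV (\<lambda>y. g y + (1 / Suc n) * h y)" for n :: nat
    using g(1) h by (intro continuous_intros)
  have iu: "integrable \<rho> u" unfolding u_def by (rule legendre_integrable(1)[OF g(1)])
  have iv: "integrable \<rho> (v n)" for n unfolding v_def by (rule legendre_integrable(1)[OF ghn])
  have ig: "integrable \<nu> g" and ih: "integrable \<nu> h"
    by (intro prob_measure_on_integrable[OF \<nu> Y] g h)+
  obtain B where B: "\<And>y. y \<in> Y \<Longrightarrow> \<bar>h y\<bar> \<le> B"
    using compact_imp_bounded[OF compact_continuous_image[OF hY Y]] by (auto simp: bounded_iff)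
  have m: "grad u \<in> borel_measurable \<rho>"
    using grad_borel_measurable[OF u] \<rho> measurable_cong_sets[of \<rho> borel borel borel]
    unfolding prob_measure_on_def by blast
  have "(\<lambda>n. \<integral>x. Suc n * (v n x - u x) \<partial>\<rho>) \<longlonglongrightarrow> (\<integral>x. - h (grad u x) \<partial>\<rho>)"
  proof (rule integral_dominated_convergence[where w = "\<lambda>_. B"])
    show "(\<lambda>x. - h (grad u x)) \<in> borel_measurable \<rho>"
      using measurable_compose[OF m borel_measurable_continuous_onI[OF h]] by simp
    show "(\<lambda>x. Suc n * (v n x - u x)) \<in> borel_measurable \<rho>" for n
      using iv iu by auto
    have G: "GDERIV (legendre Y g) x :> grad u x" if "x \<in> smooth_points (legendre Y g)" for x
      using GDERIV_grad[OF u] that by (simp add: u_def)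
    show "AE x in \<rho>. (\<lambda>n. Suc n * (v n x - u x)) \<longlonglongrightarrow> - h (grad u x)"
      using smooth
      by eventually_elim (use legendre_perturbation(2)[OF Y nonempty(2) gY hY B G] in \<open>simp add: u_def v_def\<close>)
    show "AE x in \<rho>. norm (Suc n * (v n x - u x)) \<le> B" for n
      using smooth
      by eventually_elim (use legendre_perturbation(3)[OF Y nonempty(2) gY hY B G] in \<open>simp add: u_def v_def\<close>)
  qed auto
  moreover have "- (\<integral>y. h y \<partial>\<nu>) \<le> (\<integral>x. Suc n * (v n x - u x) \<partial>\<rho>)" for n
  proof -
    have "(\<integral>y. g y \<partial>\<nu>) + (\<integral>x. u x \<partial>\<rho>) \<le> (\<integral>y. g y \<partial>\<nu>) + (1 / Suc n) * (\<integral>y. h y \<partial>\<nu>) + (\<integral>x. v n x \<partial>\<rho>)"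
      using g(2)[OF ghn[of n]] ig ih by (simp add: dual_value_def u_def v_def)
    then have "- ((1 / Suc n) * (\<integral>y. h y \<partial>\<nu>)) \<le> (\<integral>x. v n x - u x \<partial>\<rho>)"
      using iu iv[of n] by simp
    from mult_left_mono[OF this, of "Suc n"] show ?thesis
      by (simp del: of_nat_Suc)
  qed
  ultimately have "- (\<integral>y. h y \<partial>\<nu>) \<le> (\<integral>x. - h (grad u x) \<partial>\<rho>)"
    by (intro LIMSEQ_le_const) auto
  then show ?thesis by (simp add: u_def)
qed

theorem Brenier_map_exists:
  assumes ac: "absolutely_continuous lborel \<rho>"
  shows "\<exists>u :: 'a \<Rightarrow> real. convex_on UNIV u \<and> (AE x in \<rho>. u differentiable (at x)) \<and>
           distr \<rho> borel (grad u) = \<nu>"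
proof -
  obtain g where g: "continuous_on UNIV g" "\<And>h. continuous_on UNIV h \<Longrightarrow> dual_value g \<le> dual_value h"
    using dual_minimizer_exists by blast
  define u where "u = legendre Y g"
  have u: "convex_on UNIV u"
    unfolding u_def using g(1) by (intro convex_on_legendre Y nonempty) (rule continuous_on_subset, auto)
  have sets: "sets \<rho> = sets borel" "sets \<nu> = sets borel"
    using \<rho> \<nu> by (auto simp: prob_measure_on_def)
  \<comment> \<open>Absolute continuity enters here: the exceptional Lebesgue null set is null for
    \<open>\<rho>\<close> too.\<close>
  have smooth: "AE x in \<rho>. x \<in> smooth_points u"
    using absolutely_continuous_AE[OF _ ac AE_smooth_points[OF u]] sets by simp
  have "distr \<rho> borel (grad u) = \<nu>"
  proof (rule measure_eqI_continuous)
    have m: "grad u \<in> borel_measurable \<rho>"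
      using grad_borel_measurable[OF u] sets measurable_cong_sets[of \<rho> borel borel borel] by blast
    show "finite_measure (distr \<rho> borel (grad u))"
      by (intro R.finite_measure_distr m)
    fix h :: "'a \<Rightarrow> real" assume h: "continuous_on UNIV h"
    \<comment> \<open>The variation applies to \<open>- h\<close> as well as \<open>h\<close>, which
      turns the inequality into an equality.\<close>
    have "(\<integral>x. - h (grad u x) \<partial>\<rho>) \<le> (\<integral>y. - h y \<partial>\<nu>)"
      using minimizer_first_variation[OF g smooth[unfolded u_def] continuous_on_minus[OF h]]
      by (simp add: u_def)
    moreover have "(\<integral>x. h (grad u x) \<partial>\<rho>) \<le> (\<integral>y. h y \<partial>\<nu>)"
      using minimizer_first_variation[OF g smooth[unfolded u_def] h] by (simp add: u_def)
    ultimately show "(\<integral>x. h x \<partial>distr \<rho> borel (grad u)) = (\<integral>y. h y \<partial>\<nu>)"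
      using borel_measurable_continuous_onI[OF h] by (subst integral_distr[OF m]) auto
  qed (use sets N.finite_measure_axioms in auto)
  moreover have "AE x in \<rho>. u differentiable (at x)"
    using smooth by eventually_elim (rule differentiable_if_GDERIV[OF GDERIV_grad[OF u]])
  ultimately show ?thesis using u by blast
qed

end

section \<open>Couplings and the quadratic Gromov-Wasserstein cost\<close>

lemma integral_Pair:
  fixes f :: "'a \<Rightarrow> 'b::{banach, second_countable_topology}" and g :: "'a \<Rightarrow> 'c::{banach, second_countable_topology}"
  assumes "integrable M (\<lambda>x. (f x, g x))"
  shows "(\<integral>x. (f x, g x) \<partial>M) = (\<integral>x. f x \<partial>M, \<integral>x. g x \<partial>M)"
  using integral_bounded_linear[OF bounded_linear_fst assms] integral_bounded_linear[OF bounded_linear_snd assms]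
  by (simp add: prod_eq_iff)

text \<open>The rank-one matrix with \<open>y\<close> as column and \<open>x\<close> as row, so that
  it has the type of \<open>P\<close>. For centred marginals its integral is the cross-covariance
  matrix.\<close>

definition outer :: "real^'p \<Rightarrow> real^'q \<Rightarrow> real^'p^'q" where
  "outer x y = (\<chi> i j. y $ i * x $ j)"

lemma inner_outer_outer: "outer x y \<bullet> outer x' y' = (x \<bullet> x') * (y \<bullet> y')"
proof -
  have "outer x y \<bullet> outer x' y' = (\<Sum>i\<in>UNIV. \<Sum>j\<in>UNIV. (y $ i * y' $ i) * (x $ j * x' $ j))"
    by (simp add: outer_def inner_vec_def mult_ac)
  also have "\<dots> = (y \<bullet> y') * (x \<bullet> x')"
    by (simp add: inner_vec_def sum_product)
  finally show ?thesis by simp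
qed

lemma inner_matrix_outer: "P \<bullet> outer x y = (P *v x) \<bullet> y"
  by (simp add: outer_def inner_vec_def matrix_vector_mult_def sum_distrib_left mult_ac)

lemma continuous_on_outer [continuous_intros]:
  assumes "continuous_on S f" "continuous_on S g"
  shows "continuous_on S (\<lambda>z. outer (f z) (g z))"
  unfolding outer_def using assms by (intro continuous_intros)

lemma coupling_measurable:
  assumes "\<pi> \<in> couplings \<mu> \<nu>"
  shows "fst \<in> measurable \<pi> \<mu>" "snd \<in> measurable \<pi> \<nu>"
  using assms measurable_cong_sets[of \<pi> "\<mu> \<Otimes>\<^sub>M \<nu>"] by (auto simp: couplings_def)

lemma sets_pair_measure_borel:
  assumes "prob_measure_on X \<mu>" "prob_measure_on Y \<nu>"
  shows "sets (\<mu> \<Otimes>\<^sub>M \<nu>) = sets borel"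
proof -
  have "sets (\<mu> \<Otimes>\<^sub>M \<nu>) = sets (borel \<Otimes>\<^sub>M borel)"
    using assms by (intro sets_pair_measure_cong) (auto simp: prob_measure_on_def)
  then show ?thesis by (simp only: borel_prod)
qed

lemma coupling_prob_measure_on:
  assumes \<mu>: "prob_measure_on X \<mu>" "compact X" and \<nu>: "prob_measure_on Y \<nu>" "compact Y"
    and \<pi>: "\<pi> \<in> couplings \<mu> \<nu>"
  shows "prob_measure_on (X \<times> Y) \<pi>"
proof -
  interpret prob_space \<pi> using \<pi> by (simp add: couplings_def)
  have sets: "sets \<pi> = sets borel"
    using \<pi> sets_pair_measure_borel[OF \<mu>(1) \<nu>(1)] by (simp add: couplings_def)
  have marg: "distr \<pi> \<mu> fst = \<mu>" "distr \<pi> \<nu> snd = \<nu>"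
    using \<pi> by (auto simp: couplings_def)
  have "AE z in \<pi>. fst z \<in> X"
  proof (rule AE_distrD[OF coupling_measurable(1)[OF \<pi>]])
    show "AE x in distr \<pi> \<mu> fst. x \<in> X"
      unfolding marg by (rule prob_measure_on_AE[OF \<mu>])
  qed
  moreover have "AE z in \<pi>. snd z \<in> Y"
  proof (rule AE_distrD[OF coupling_measurable(2)[OF \<pi>]])
    show "AE x in distr \<pi> \<nu> snd. x \<in> Y"
      unfolding marg by (rule prob_measure_on_AE[OF \<nu>])
  qed
  ultimately have "AE z in \<pi>. z \<in> X \<times> Y" by eventually_elim (simp add: mem_Times_iff)
  then have "emeasure \<pi> (X \<times> Y) = 1"
    using sets \<mu>(2) \<nu>(2) by (intro emeasure_eq_1_AE) (auto intro!: borel_compact compact_Times)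
  then show ?thesis using sets prob_space_axioms by (simp add: prob_measure_on_def)
qed

lemma graph_coupling_in_couplings:
  assumes \<mu>: "prob_space \<mu>" and T: "pushes_forward T \<mu> \<nu>"
  shows "graph_coupling \<mu> \<nu> T \<in> couplings \<mu> \<nu>"
proof -
  have [measurable]: "T \<in> measurable \<mu> \<nu>" and d: "distr \<mu> \<nu> T = \<nu>"
    using T by (auto simp: pushes_forward_def)
  have "prob_space (graph_coupling \<mu> \<nu> T)"
    unfolding graph_coupling_def by (intro prob_space.prob_space_distr \<mu>) measurable
  then show ?thesis
    unfolding couplings_def graph_coupling_def
    by (simp add: distr_distr comp_def d distr_id)
qed

section \<open>Couplings of compactly supported measures and a criterion for maximality\<close>

locale compact_marginals =
  fixes X :: "'a::euclidean_space set" and Y :: "'b::euclidean_space set" and \<mu> \<nu>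
  assumes X: "compact X" and Y: "compact Y"
    and \<mu>: "prob_measure_on X \<mu>" and \<nu>: "prob_measure_on Y \<nu>"
begin

lemma coupling_integrable:
  fixes f :: "'a \<times> 'b \<Rightarrow> 'c::{banach, second_countable_topology}"
  assumes "\<pi> \<in> couplings \<mu> \<nu>" "continuous_on UNIV f"
  shows "integrable \<pi> f"
  using prob_measure_on_integrable[OF coupling_prob_measure_on[OF \<mu> X \<nu> Y assms(1)]] assms X Y
  by (blast intro: compact_Times)

lemma coupling_integral_fst:
  fixes f :: "'a \<Rightarrow> 'c::{banach, second_countable_topology}"
  assumes "\<pi> \<in> couplings \<mu> \<nu>" "continuous_on UNIV f"
  shows "(\<integral>z. f (fst z) \<partial>\<pi>) = (\<integral>x. f x \<partial>\<mu>)"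
proof -
  have "f \<in> borel_measurable \<mu>"
    using borel_measurable_integrable prob_measure_on_integrable[OF \<mu> X assms(2)] by blast
  then have "(\<integral>x. f x \<partial>distr \<pi> \<mu> fst) = (\<integral>z. f (fst z) \<partial>\<pi>)"
    by (rule integral_distr[OF coupling_measurable(1)[OF assms(1)]])
  then show ?thesis using assms(1) by (simp add: couplings_def)
qed

lemma coupling_integral_snd:
  fixes f :: "'b \<Rightarrow> 'c::{banach, second_countable_topology}"
  assumes "\<pi> \<in> couplings \<mu> \<nu>" "continuous_on UNIV f"
  shows "(\<integral>z. f (snd z) \<partial>\<pi>) = (\<integral>y. f y \<partial>\<nu>)"
proof -
  have "f \<in> borel_measurable \<nu>"
    using borel_measurable_integrable prob_measure_on_integrable[OF \<nu> Y assms(2)] by blast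
  then have "(\<integral>x. f x \<partial>distr \<pi> \<nu> snd) = (\<integral>z. f (snd z) \<partial>\<pi>)"
    by (rule integral_distr[OF coupling_measurable(2)[OF assms(1)]])
  then show ?thesis using assms(1) by (simp add: couplings_def)
qed

text \<open>Weak duality: with \<open>v\<close> the Legendre transform of \<open>\<phi>\<close>, the bound
  \<open>a x \<bullet> b y \<le> \<phi> (a x) + v (b y)\<close> holds everywhere and is an equality on the support of
  \<open>\<gamma>\<close>, while its right-hand side has the same integral against every coupling.\<close>

lemma subgradient_coupling_maximal:
  fixes a :: "'a \<Rightarrow> 'c::euclidean_space"
  assumes \<pi>: "\<pi> \<in> couplings \<mu> \<nu>" and \<gamma>: "\<gamma> \<in> couplings \<mu> \<nu>"
    and a: "continuous_on UNIV a" and b: "continuous_on UNIV b" and \<phi>: "continuous_on UNIV \<phi>"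
    and sub: "AE z in \<gamma>. \<forall>w. \<phi> (a (fst z)) + b (snd z) \<bullet> (w - a (fst z)) \<le> \<phi> w"
  shows "(\<integral>z. a (fst z) \<bullet> b (snd z) \<partial>\<pi>) \<le> (\<integral>z. a (fst z) \<bullet> b (snd z) \<partial>\<gamma>)"
proof -
  \<comment> \<open>Conjugating \<open>\<phi>\<close> over the compact image of \<open>X\<close>
    keeps the dual potential finite and continuous.\<close>
  define K where "K = a ` X"
  have K: "compact K" "K \<noteq> {}"
    using compact_continuous_image[OF continuous_on_subset[OF a] X] prob_measure_on_nonempty[OF \<mu>]
    by (auto simp: K_def)
  have \<phi>K: "continuous_on K \<phi>" using \<phi> continuous_on_subset by blast
  have c1: "continuous_on UNIV (\<lambda>x. \<phi> (a x))"
    using continuous_on_compose2[OF \<phi> a] by simp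
  have c2: "continuous_on UNIV (\<lambda>y. legendre K \<phi> (b y))"
    using continuous_on_compose2[OF continuous_on_legendre[OF K \<phi>K] b] by simp
  have "continuous_on UNIV (\<lambda>z. a (fst z))" "continuous_on UNIV (\<lambda>z. b (snd z))"
    by (intro continuous_on_compose2[OF a] continuous_on_compose2[OF b] continuous_intros; simp)+
  then have c3: "continuous_on UNIV (\<lambda>z. a (fst z) \<bullet> b (snd z))"
    by (rule continuous_on_inner)
  have c1': "continuous_on UNIV (\<lambda>z::'a \<times> 'b. \<phi> (a (fst z)))"
    by (intro continuous_on_compose2[OF c1] continuous_intros) simp
  have c2': "continuous_on UNIV (\<lambda>z::'a \<times> 'b. legendre K \<phi> (b (snd z)))"
    by (intro continuous_on_compose2[OF c2] continuous_intros) simp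
  note c4 = continuous_on_add[OF c1' c2']
  have dual: "(\<integral>z. \<phi> (a (fst z)) + legendre K \<phi> (b (snd z)) \<partial>\<sigma>) = (\<integral>x. \<phi> (a x) \<partial>\<mu>) + (\<integral>y. legendre K \<phi> (b y) \<partial>\<nu>)"
    if "\<sigma> \<in> couplings \<mu> \<nu>" for \<sigma>
    using coupling_integral_fst[OF that c1] coupling_integral_snd[OF that c2]
      coupling_integrable[OF that c1'] coupling_integrable[OF that c2']
    by (simp add: Bochner_Integration.integral_add)
  have AEX: "AE z in \<sigma>. fst z \<in> X" if "\<sigma> \<in> couplings \<mu> \<nu>" for \<sigma>
    using prob_measure_on_AE[OF coupling_prob_measure_on[OF \<mu> X \<nu> Y that] compact_Times[OF X Y]]
    by eventually_elim (simp add: mem_Times_iff)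
  have "(\<integral>z. a (fst z) \<bullet> b (snd z) \<partial>\<pi>) \<le> (\<integral>z. \<phi> (a (fst z)) + legendre K \<phi> (b (snd z)) \<partial>\<pi>)"
  proof (rule integral_mono_AE[OF coupling_integrable[OF \<pi> c3] coupling_integrable[OF \<pi> c4]])
    show "AE z in \<pi>. a (fst z) \<bullet> b (snd z) \<le> \<phi> (a (fst z)) + legendre K \<phi> (b (snd z))"
      using AEX[OF \<pi>]
    proof eventually_elim
      case (elim z)
      then have "a (fst z) \<in> K" by (simp add: K_def)
      from legendre_upper[OF K(1) \<phi>K this, of "b (snd z)"] show ?case by (simp add: inner_commute)
    qed
  qed
  also have "\<dots> = (\<integral>z. \<phi> (a (fst z)) + legendre K \<phi> (b (snd z)) \<partial>\<gamma>)"
    using dual[OF \<pi>] dual[OF \<gamma>] by simp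
  also have "\<dots> \<le> (\<integral>z. a (fst z) \<bullet> b (snd z) \<partial>\<gamma>)"
  proof (rule integral_mono_AE[OF coupling_integrable[OF \<gamma> c4] coupling_integrable[OF \<gamma> c3]])
    show "AE z in \<gamma>. \<phi> (a (fst z)) + legendre K \<phi> (b (snd z)) \<le> a (fst z) \<bullet> b (snd z)"
      using sub
    proof eventually_elim
      case (elim z)
      \<comment> \<open>At a maximizer \<open>w\<close>, the subgradient inequality rearranges to
        the reverse of Fenchel's inequality.\<close>
      obtain w where "w \<in> K" "legendre K \<phi> (b (snd z)) = b (snd z) \<bullet> w - \<phi> w"
        using legendre_attained[OF K \<phi>K] by blast
      then show ?case using elim[rule_format, of w] by (simp add: inner_diff_right inner_commute)
    qed
  qed
  finally show ?thesis .
qed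

text \<open>An almost-everywhere statement transfers along the map from \<open>x\<close> to
  \<open>(x, T x)\<close> once its set is measurable. This one is closed, being an intersection over
  \<open>w\<close> of closed conditions.\<close>

lemma AE_graph_coupling_subgradient:
  fixes a :: "'a \<Rightarrow> 'c::euclidean_space"
  assumes T: "pushes_forward T \<mu> \<nu>"
    and a: "continuous_on UNIV a" and b: "continuous_on UNIV b" and \<phi>: "continuous_on UNIV \<phi>"
    and sub: "AE x in \<mu>. \<forall>w. \<phi> (a x) + b (T x) \<bullet> (w - a x) \<le> \<phi> w"
  shows "AE z in graph_coupling \<mu> \<nu> T. \<forall>w. \<phi> (a (fst z)) + b (snd z) \<bullet> (w - a (fst z)) \<le> \<phi> w"
proof -
  have c: "continuous_on UNIV (\<lambda>z::'a \<times> 'b. a (fst z))" "continuous_on UNIV (\<lambda>z::'a \<times> 'b. b (snd z))"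
    by (intro continuous_on_compose2[OF a] continuous_on_compose2[OF b] continuous_intros; simp)+
  have c': "continuous_on UNIV (\<lambda>z::'a \<times> 'b. \<phi> (a (fst z)))"
    using continuous_on_compose2[OF \<phi> c(1)] by simp
  have "closed {z :: 'a \<times> 'b. \<forall>w. \<phi> (a (fst z)) + b (snd z) \<bullet> (w - a (fst z)) \<le> \<phi> w}"
    by (intro closed_Collect_all closed_Collect_le continuous_intros c c')
  then have "{z :: 'a \<times> 'b. \<forall>w. \<phi> (a (fst z)) + b (snd z) \<bullet> (w - a (fst z)) \<le> \<phi> w} \<in> sets borel"
    by simp
  moreover note sets_pair_measure_borel[OF \<mu> \<nu>]
  moreover from this have "space (\<mu> \<Otimes>\<^sub>M \<nu>) = UNIV"
    using sets_eq_imp_space_eq by fastforce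
  ultimately have "{z \<in> space (\<mu> \<Otimes>\<^sub>M \<nu>). \<forall>w. \<phi> (a (fst z)) + b (snd z) \<bullet> (w - a (fst z)) \<le> \<phi> w} \<in> sets (\<mu> \<Otimes>\<^sub>M \<nu>)"
    by simp
  then show ?thesis
    unfolding graph_coupling_def
    using T sub by (subst AE_distr_iff) (auto simp: pushes_forward_def)
qed

end

section \<open>Expansion of the cost of a coupling\<close>

lemma inner_integral_bilinear:
  fixes U V :: "'a \<Rightarrow> 'b::euclidean_space"
  assumes "integrable M U" "integrable M V"
  shows "(\<integral>z'. (\<integral>z. U z \<bullet> V z' \<partial>M) \<partial>M) = (\<integral>z. U z \<partial>M) \<bullet> (\<integral>z. V z \<partial>M)"
  using assms by simp

text \<open>After expanding the square, the integrand is a sum of products of a function of \<open>z\<close> and a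
  function of \<open>z'\<close>, i.e. an inner product \<open>U z \<bullet> V z'\<close> of Euclidean vectors.\<close>

lemma gw_cost_eq:
  fixes X :: "(real^'p) set" and Y :: "(real^'q) set"
  assumes "compact_marginals X Y \<mu> \<nu>"
    and "(\<integral>x. x \<partial>\<mu>) = 0" and "(\<integral>y. y \<partial>\<nu>) = 0"
  shows "\<exists>C. \<forall>\<pi>\<in>couplings \<mu> \<nu>. gw_cost \<pi> =
    C - 4 * (\<integral>z. (norm (fst z))\<^sup>2 * (norm (snd z))\<^sup>2 \<partial>\<pi>) - 8 * (norm (\<integral>z. outer (fst z) (snd z) \<partial>\<pi>))\<^sup>2"
proof -
  interpret compact_marginals X Y \<mu> \<nu> by fact
  define a :: "(real^'p) \<times> (real^'q) \<Rightarrow> real" where "a z = (norm (fst z))\<^sup>2 - (norm (snd z))\<^sup>2" for z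
  define w :: "(real^'p) \<times> (real^'q) \<Rightarrow> (real^'p) \<times> (real^'q)" where "w z = (fst z, - snd z)" for z
  have ca: "continuous_on UNIV a" and cw: "continuous_on UNIV w"
    unfolding a_def w_def by (intro continuous_intros)+
  \<comment> \<open>Moments of the marginals alone, fixed before \<open>\<pi>\<close>; the constant
    is built from them.\<close>
  define Mx where "Mx = (\<integral>x. outer x x \<partial>\<mu>)"
  define My where "My = (\<integral>y. outer y y \<partial>\<nu>)"
  define A where "A = (\<integral>x. (norm x)\<^sup>2 \<partial>\<mu>) - (\<integral>y. (norm y)\<^sup>2 \<partial>\<nu>)"
  define A4 where "A4 = (\<integral>x. (norm x)^4 \<partial>\<mu>) + (\<integral>y. (norm y)^4 \<partial>\<nu>)"
  show ?thesis
  proof (intro exI ballI)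
    fix \<pi> assume \<pi>: "\<pi> \<in> couplings \<mu> \<nu>"
    interpret prob_space \<pi> using \<pi> by (simp add: couplings_def)
    note int = coupling_integrable[OF \<pi>]
    define S where "S = (\<integral>z. (norm (fst z))\<^sup>2 * (norm (snd z))\<^sup>2 \<partial>\<pi>)"
    define M where "M = (\<integral>z. outer (fst z) (snd z) \<partial>\<pi>)"
    \<comment> \<open>The slots are the terms of the square of
      \<open>a z + a z' - 2 * (w z \<bullet> z')\<close>. The sign in \<open>w\<close> gives
      \<open>w z \<bullet> z' = x \<bullet> x' - y \<bullet> y'\<close>, and products of two inner
      products become inner products of outer products.\<close>
    define U where "U z = ((a z)\<^sup>2, 1::real, outer (fst z) (fst z), outer (snd z) (snd z),
        outer (fst z) (snd z), a z, a z *\<^sub>R w z, w z)" for z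
    define V where "V z = (1::real, (a z)\<^sup>2, 4 *\<^sub>R outer (fst z) (fst z), 4 *\<^sub>R outer (snd z) (snd z),
        (-8) *\<^sub>R outer (fst z) (snd z), 2 * a z, (-4) *\<^sub>R z, (-4 * a z) *\<^sub>R z)" for z
    have UV: "((norm (x - x'))\<^sup>2 - (norm (y - y'))\<^sup>2)\<^sup>2 = U (x, y) \<bullet> V (x', y')" for x x' y y'
    proof -
      have "(norm (x - x'))\<^sup>2 - (norm (y - y'))\<^sup>2 = a (x, y) + a (x', y') - 2 * (x \<bullet> x' - y \<bullet> y')"
        by (simp add: a_def power2_norm_eq_inner algebra_simps inner_commute)
      moreover have "U (x, y) \<bullet> V (x', y') = (a (x, y) + a (x', y') - 2 * (x \<bullet> x' - y \<bullet> y'))\<^sup>2"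
        by (simp add: U_def V_def w_def inner_outer_outer power2_eq_square algebra_simps)
      ultimately show ?thesis by simp
    qed
    \<comment> \<open>Centring puts 0 in the last slot of the integral of \<open>U\<close> and in
      the seventh slot of that of \<open>V\<close>, so the mixed moments opposite them, which depend
      on \<open>\<pi>\<close>, drop out.\<close>
    have mean: "(\<integral>z. w z \<partial>\<pi>) = 0"
    proof -
      have "(\<integral>z. (fst z, - snd z) \<partial>\<pi>) = (\<integral>z. fst z \<partial>\<pi>, \<integral>z. - snd z \<partial>\<pi>)"
        by (intro integral_Pair int continuous_intros)
      then show ?thesis
        using coupling_integral_fst[OF \<pi>, of "\<lambda>x. x"] coupling_integral_snd[OF \<pi>, of "\<lambda>y. y"] assms(2,3)
        by (simp add: w_def zero_prod_def)
    qed
    have mean': "(\<integral>z. z \<partial>\<pi>) = 0"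
    proof -
      have "(\<integral>z. (fst z, snd z) \<partial>\<pi>) = (\<integral>z. fst z \<partial>\<pi>, \<integral>z. snd z \<partial>\<pi>)"
        by (intro integral_Pair int continuous_intros)
      then show ?thesis
        using coupling_integral_fst[OF \<pi>, of "\<lambda>x. x"] coupling_integral_snd[OF \<pi>, of "\<lambda>y. y"] assms(2,3)
        by (simp add: zero_prod_def)
    qed
    have Mx: "(\<integral>z. outer (fst z) (fst z) \<partial>\<pi>) = Mx" unfolding Mx_def
      by (intro coupling_integral_fst[OF \<pi>] continuous_intros)
    have My: "(\<integral>z. outer (snd z) (snd z) \<partial>\<pi>) = My" unfolding My_def
      by (intro coupling_integral_snd[OF \<pi>] continuous_intros)
    have A: "(\<integral>z. a z \<partial>\<pi>) = A"
    proof -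
      have "(\<integral>z. a z \<partial>\<pi>) = (\<integral>z. (norm (fst z))\<^sup>2 \<partial>\<pi>) - (\<integral>z. (norm (snd z))\<^sup>2 \<partial>\<pi>)"
        unfolding a_def by (intro Bochner_Integration.integral_diff int continuous_intros)
      also have "(\<integral>z. (norm (fst z))\<^sup>2 \<partial>\<pi>) = (\<integral>x. (norm x)\<^sup>2 \<partial>\<mu>)"
        by (intro coupling_integral_fst[OF \<pi>] continuous_intros)
      also have "(\<integral>z. (norm (snd z))\<^sup>2 \<partial>\<pi>) = (\<integral>y. (norm y)\<^sup>2 \<partial>\<nu>)"
        by (intro coupling_integral_snd[OF \<pi>] continuous_intros)
      finally show ?thesis by (simp add: A_def)
    qed
    have A2: "(\<integral>z. (a z)\<^sup>2 \<partial>\<pi>) = A4 - 2 * S"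
    proof -
      have "(a z)\<^sup>2 = (norm (fst z))^4 + (norm (snd z))^4 - 2 * ((norm (fst z))\<^sup>2 * (norm (snd z))\<^sup>2)" for z
        by (simp add: a_def power2_diff)
      then have "(\<integral>z. (a z)\<^sup>2 \<partial>\<pi>) = (\<integral>z. (norm (fst z))^4 + (norm (snd z))^4 - 2 * ((norm (fst z))\<^sup>2 * (norm (snd z))\<^sup>2) \<partial>\<pi>)"
        by simp
      also have "\<dots> = (\<integral>z. (norm (fst z))^4 + (norm (snd z))^4 \<partial>\<pi>) - (\<integral>z. 2 * ((norm (fst z))\<^sup>2 * (norm (snd z))\<^sup>2) \<partial>\<pi>)"
        by (intro Bochner_Integration.integral_diff int continuous_intros)
      also have "(\<integral>z. (norm (fst z))^4 + (norm (snd z))^4 \<partial>\<pi>) = (\<integral>z. (norm (fst z))^4 \<partial>\<pi>) + (\<integral>z. (norm (snd z))^4 \<partial>\<pi>)"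
        by (intro Bochner_Integration.integral_add int continuous_intros)
      also have "(\<integral>z. (norm (fst z))^4 \<partial>\<pi>) = (\<integral>x. (norm x)^4 \<partial>\<mu>)"
        by (intro coupling_integral_fst[OF \<pi>] continuous_intros)
      also have "(\<integral>z. (norm (snd z))^4 \<partial>\<pi>) = (\<integral>y. (norm y)^4 \<partial>\<nu>)"
        by (intro coupling_integral_snd[OF \<pi>] continuous_intros)
      finally show ?thesis by (simp add: A4_def S_def)
    qed
    have cU: "continuous_on UNIV U" and cV: "continuous_on UNIV V"
      unfolding U_def V_def by (intro continuous_intros ca cw)+
    have "gw_cost \<pi> = (\<integral>z'. (\<integral>z. U z \<bullet> V z' \<partial>\<pi>) \<partial>\<pi>)"
      by (simp add: gw_cost_def UV case_prod_beta')
    also have "\<dots> = (\<integral>z. U z \<partial>\<pi>) \<bullet> (\<integral>z. V z \<partial>\<pi>)"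
      by (intro inner_integral_bilinear int cU cV)
    also have "(\<integral>z. U z \<partial>\<pi>) = (A4 - 2 * S, 1, Mx, My, M, A, \<integral>z. a z *\<^sub>R w z \<partial>\<pi>, 0)"
    proof -
      have "(\<integral>z. U z \<partial>\<pi>) = (\<integral>z. (a z)\<^sup>2 \<partial>\<pi>, \<integral>z. 1 \<partial>\<pi>, \<integral>z. outer (fst z) (fst z) \<partial>\<pi>,
          \<integral>z. outer (snd z) (snd z) \<partial>\<pi>, \<integral>z. outer (fst z) (snd z) \<partial>\<pi>, \<integral>z. a z \<partial>\<pi>,
          \<integral>z. a z *\<^sub>R w z \<partial>\<pi>, \<integral>z. w z \<partial>\<pi>)"
        unfolding U_def by (subst integral_Pair, intro int continuous_intros ca cw)+ simp
      then show ?thesis by (simp add: A2 Mx My A mean mean' M_def prob_space)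
    qed
    also have "(\<integral>z. V z \<partial>\<pi>) = (1, A4 - 2 * S, 4 *\<^sub>R Mx, 4 *\<^sub>R My, (-8) *\<^sub>R M, 2 * A, 0, \<integral>z. (-4 * a z) *\<^sub>R z \<partial>\<pi>)"
    proof -
      have "(\<integral>z. V z \<partial>\<pi>) = (\<integral>z. 1 \<partial>\<pi>, \<integral>z. (a z)\<^sup>2 \<partial>\<pi>, \<integral>z. 4 *\<^sub>R outer (fst z) (fst z) \<partial>\<pi>,
          \<integral>z. 4 *\<^sub>R outer (snd z) (snd z) \<partial>\<pi>, \<integral>z. (-8) *\<^sub>R outer (fst z) (snd z) \<partial>\<pi>, \<integral>z. 2 * a z \<partial>\<pi>,
          \<integral>z. (-4) *\<^sub>R z \<partial>\<pi>, \<integral>z. (-4 * a z) *\<^sub>R z \<partial>\<pi>)"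
        unfolding V_def by (subst integral_Pair, intro int continuous_intros ca cw)+ simp
      then show ?thesis by (simp add: A2 Mx My A mean mean' M_def prob_space)
    qed
    \<comment> \<open>\<open>A4 - 2 * S\<close> occurs in each of the first two slots, whence
      \<open>2 * A4\<close> and \<open>- 4 * S\<close>.\<close>
    finally show "gw_cost \<pi> = (2 * A4 + 4 * (norm Mx)\<^sup>2 + 4 * (norm My)\<^sup>2 + 2 * A\<^sup>2) - 4 * S - 8 * (norm M)\<^sup>2"
      by (simp add: power2_norm_eq_inner) (simp add: power2_eq_square algebra_simps)
  qed
qed

lemma bilinear_objective_eq:
  assumes "compact_marginals X Y \<mu> \<nu>" and \<pi>: "\<pi> \<in> couplings \<mu> \<nu>"
  shows "bilinear_objective \<pi> P = P \<bullet> (\<integral>z. outer (fst z) (snd z) \<partial>\<pi>)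
    + (\<integral>z. (norm (fst z))\<^sup>2 * (norm (snd z))\<^sup>2 \<partial>\<pi>) - 1/8 * (norm P)\<^sup>2"
proof -
  interpret compact_marginals X Y \<mu> \<nu> by fact
  have "(\<integral>z. P \<bullet> outer (fst z) (snd z) + (norm (fst z))\<^sup>2 * (norm (snd z))\<^sup>2 \<partial>\<pi>)
    = (\<integral>z. P \<bullet> outer (fst z) (snd z) \<partial>\<pi>) + (\<integral>z. (norm (fst z))\<^sup>2 * (norm (snd z))\<^sup>2 \<partial>\<pi>)"
    by (intro Bochner_Integration.integral_add coupling_integrable[OF \<pi>] continuous_intros)
  moreover have "(\<integral>z. P \<bullet> outer (fst z) (snd z) \<partial>\<pi>) = P \<bullet> (\<integral>z. outer (fst z) (snd z) \<partial>\<pi>)"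
    by (intro integral_inner_right coupling_integrable[OF \<pi>] continuous_intros)
  ultimately show ?thesis
    by (simp add: bilinear_objective_def case_prod_beta' inner_matrix_outer)
qed

text \<open>The supremum over \<open>P\<close> is attained at four times the cross-covariance matrix of \<open>\<pi>\<close>.\<close>

lemma inner_minus_norm_sq_le:
  fixes P M :: "'a::real_inner"
  shows "P \<bullet> M - 1/8 * (norm P)\<^sup>2 \<le> 2 * (norm M)\<^sup>2"
    and "(4 *\<^sub>R M) \<bullet> M - 1/8 * (norm (4 *\<^sub>R M))\<^sup>2 = 2 * (norm M)\<^sup>2"
proof -
  have "0 \<le> (P - 4 *\<^sub>R M) \<bullet> (P - 4 *\<^sub>R M)" by (rule inner_ge_zero)
  then show "P \<bullet> M - 1/8 * (norm P)\<^sup>2 \<le> 2 * (norm M)\<^sup>2"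
    by (simp add: power2_norm_eq_inner inner_diff inner_commute algebra_simps)
qed (simp add: power2_norm_eq_inner power_mult_distrib)

section \<open>The image measure, existence of the map and optimality of its graph coupling\<close>

lemma prob_measure_on_distr:
  fixes A :: "'a::euclidean_space \<Rightarrow> 'b::euclidean_space"
  assumes \<mu>: "prob_measure_on X \<mu>" "compact X" and A: "continuous_on UNIV A"
  shows "prob_measure_on (A ` X) (distr \<mu> borel A)"
proof -
  interpret prob_space \<mu> using \<mu> by (simp add: prob_measure_on_def)
  have m: "A \<in> borel_measurable \<mu>"
    using borel_measurable_continuous_onI[OF A] \<mu>(1) measurable_cong_sets[of \<mu> borel borel borel]
    unfolding prob_measure_on_def by blast
  interpret D: prob_space "distr \<mu> borel A" by (rule prob_space_distr[OF m])
  have K: "A ` X \<in> sets borel"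
    using compact_continuous_image[OF continuous_on_subset[OF A] \<mu>(2)] by (simp add: borel_compact)
  have "AE y in distr \<mu> borel A. y \<in> A ` X"
    using K m by (subst AE_distr_iff) (auto intro: eventually_mono[OF prob_measure_on_AE[OF \<mu>]])
  then have "emeasure (distr \<mu> borel A) (A ` X) = 1"
    using K by (intro D.emeasure_eq_1_AE) auto
  then show ?thesis using D.prob_space_axioms by (simp add: prob_measure_on_def)
qed

theorem proposition4p2p4:
  fixes X :: "(real^'p) set" and Y :: "(real^'q) set"
    and \<mu> :: "(real^'p) measure" and \<nu> :: "(real^'q) measure"
    and \<pi>opt :: "((real^'p) \<times> (real^'q)) measure" and Popt :: "real^'p^'q"
  assumes "CARD('p) \<ge> CARD('q)"
    and "compact X" and "compact Y"
    and "prob_measure_on X \<mu>" and "prob_measure_on Y \<nu>"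
    and "absolutely_continuous lborel \<mu>"
    and "(\<integral>x. x \<partial>\<mu>) = 0" and "(\<integral>y. y \<partial>\<nu>) = 0"
    and "is_arg_max (\<lambda>(\<pi>, P). bilinear_objective \<pi> P) (\<lambda>(\<pi>, P). \<pi> \<in> couplings \<mu> \<nu>) (\<pi>opt, Popt)"
    and "surj (\<lambda>x. Popt *v x)"
  shows "(\<exists>u :: real^'q \<Rightarrow> real. convex_on UNIV u \<and>
            (AE x in \<mu>. u differentiable (at (Popt *v x))) \<and>
            pushes_forward (\<lambda>x. grad u (Popt *v x)) \<mu> \<nu>) \<and>
         (\<forall>u :: real^'q \<Rightarrow> real. convex_on UNIV u \<and>
            pushes_forward (\<lambda>x. grad u (Popt *v x)) \<mu> \<nu> \<longrightarrow>
            (\<lambda>x. grad u (Popt *v x)) \<in> radial_maps \<mu> \<nu> \<longrightarrow>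
            is_arg_min gw_cost (\<lambda>\<pi>. \<pi> \<in> couplings \<mu> \<nu>)
              (graph_coupling \<mu> \<nu> (\<lambda>x. grad u (Popt *v x))))"
proof -
  note X = \<open>compact X\<close> and Y = \<open>compact Y\<close> and \<mu> = \<open>prob_measure_on X \<mu>\<close> and \<nu> = \<open>prob_measure_on Y \<nu>\<close>
  have marginals: "compact_marginals X Y \<mu> \<nu>"
    by unfold_locales (rule X Y \<mu> \<nu>)+
  interpret compact_marginals X Y \<mu> \<nu> by (rule marginals)
  have sets: "sets \<mu> = sets borel" "sets \<nu> = sets borel" and "prob_space \<mu>"
    using \<mu> \<nu> by (auto simp: prob_measure_on_def)
  define A where "A x = Popt *v x" for x
  have A: "linear A" "surj A" and cA: "continuous_on UNIV A"
    using \<open>surj (\<lambda>x. Popt *v x)\<close> by (auto simp: A_def[abs_def] matrix_vector_mul_linear intro!: continuous_intros)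
  have mA: "A \<in> borel_measurable \<mu>"
    using borel_measurable_continuous_onI[OF cA] sets measurable_cong_sets[of \<mu> borel borel borel] by blast
  \<comment> \<open>Brenier's theorem is applied between this image of \<open>\<mu>\<close> and
    \<open>\<nu>\<close>, both on the smaller space.\<close>
  define \<rho> where "\<rho> = distr \<mu> borel A"
  have ac: "absolutely_continuous lborel \<rho>"
    unfolding \<rho>_def by (rule absolutely_continuous_linear_surj[OF sets(1) \<open>absolutely_continuous lborel \<mu>\<close> A])
  have "compactly_supported_pair (A ` X) Y \<rho> \<nu>"
    unfolding compactly_supported_pair_def \<rho>_def
    using compact_continuous_image[OF continuous_on_subset[OF cA] X] prob_measure_on_distr[OF \<mu> X cA] Y \<nu>
    by simp
  then obtain u where u: "convex_on UNIV u" "AE y in \<rho>. u differentiable (at y)"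
    and push: "distr \<rho> borel (grad u) = \<nu>"
    using compactly_supported_pair.Brenier_map_exists[OF _ ac] by blast
  have "distr \<mu> \<nu> (\<lambda>x. grad u (A x)) = distr \<mu> borel (grad u \<circ> A)"
    by (rule distr_cong) (simp_all add: sets)
  also have "\<dots> = \<nu>"
    using distr_distr[OF grad_borel_measurable[OF u(1)] mA] push by (simp add: \<rho>_def)
  finally have "pushes_forward (\<lambda>x. grad u (A x)) \<mu> \<nu>"
    using measurable_compose[OF mA grad_borel_measurable[OF u(1)]] measurable_cong_sets[OF refl sets(2), of \<mu>]
    by (auto simp: pushes_forward_def)
  moreover have "AE x in \<mu>. u differentiable (at (A x))"
    by (rule AE_distrD[OF mA u(2)[unfolded \<rho>_def]])
  ultimately have part1: "\<exists>u :: real^'q \<Rightarrow> real. convex_on UNIV u \<and>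
            (AE x in \<mu>. u differentiable (at (A x))) \<and> pushes_forward (\<lambda>x. grad u (A x)) \<mu> \<nu>"
    using u(1) by blast
  have part2: "is_arg_min gw_cost (\<lambda>\<pi>. \<pi> \<in> couplings \<mu> \<nu>) (graph_coupling \<mu> \<nu> (\<lambda>x. grad u (A x)))"
    if u: "convex_on UNIV u" and T: "pushes_forward (\<lambda>x. grad u (A x)) \<mu> \<nu>"
      and rad: "(\<lambda>x. grad u (A x)) \<in> radial_maps \<mu> \<nu>" for u :: "real^'q \<Rightarrow> real"
  proof -
    define \<gamma> where "\<gamma> = graph_coupling \<mu> \<nu> (\<lambda>x. grad u (A x))"
    have \<gamma>: "\<gamma> \<in> couplings \<mu> \<nu>"
      unfolding \<gamma>_def by (rule graph_coupling_in_couplings[OF \<open>prob_space \<mu>\<close> T])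
    define M where "M \<pi> = (\<integral>z. outer (fst z) (snd z) \<partial>\<pi>)" for \<pi> :: "((real^'p) \<times> (real^'q)) measure"
    define S where "S \<pi> = (\<integral>z. (norm (fst z))\<^sup>2 * (norm (snd z))\<^sup>2 \<partial>\<pi>)" for \<pi> :: "((real^'p) \<times> (real^'q)) measure"
    have opt: "\<pi>opt \<in> couplings \<mu> \<nu>"
      "\<And>\<pi> P. \<pi> \<in> couplings \<mu> \<nu> \<Longrightarrow> bilinear_objective \<pi> P \<le> bilinear_objective \<pi>opt Popt"
      using assms(9) by (auto simp: is_arg_max_def not_less)
    have cu: "continuous_on UNIV u" by (rule convex_on_continuous[OF open_UNIV u])
    \<comment> \<open>For almost every \<open>x\<close>, \<open>grad u (A x)\<close> is therefore a
      true gradient rather than the default value, and so a subgradient.\<close>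
    have "AE y in \<rho>. y \<in> smooth_points u"
      using absolutely_continuous_AE[OF _ ac AE_smooth_points[OF u]] by (simp add: \<rho>_def)
    then have "AE x in \<mu>. A x \<in> smooth_points u"
      unfolding \<rho>_def by (rule AE_distrD[OF mA])
    then have "AE x in \<mu>. \<forall>w. u (A x) + grad u (A x) \<bullet> (w - A x) \<le> u w"
      by eventually_elim (intro allI convex_on_above_tangent_plane[OF u] GDERIV_grad[OF u])
    then have "AE z in \<gamma>. \<forall>w. u (A (fst z)) + snd z \<bullet> (w - A (fst z)) \<le> u w"
      unfolding \<gamma>_def
      by (rule AE_graph_coupling_subgradient[OF T cA continuous_on_id cu])
    then have "(\<integral>z. A (fst z) \<bullet> snd z \<partial>\<pi>opt) \<le> (\<integral>z. A (fst z) \<bullet> snd z \<partial>\<gamma>)"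
      by (rule subgradient_coupling_maximal[OF opt(1) \<gamma> cA continuous_on_id cu])
    moreover have "(\<integral>z. A (fst z) \<bullet> snd z \<partial>\<pi>) = Popt \<bullet> M \<pi>" if \<pi>: "\<pi> \<in> couplings \<mu> \<nu>" for \<pi>
    proof -
      have "(\<integral>z. Popt \<bullet> outer (fst z) (snd z) \<partial>\<pi>) = Popt \<bullet> M \<pi>"
        unfolding M_def by (intro integral_inner_right coupling_integrable[OF \<pi>] continuous_intros)
      then show ?thesis by (simp add: A_def inner_matrix_outer)
    qed
    ultimately have bil: "Popt \<bullet> M \<pi>opt \<le> Popt \<bullet> M \<gamma>" using opt(1) \<gamma> by simp
    obtain f :: "real \<Rightarrow> real" where f: "convex_on UNIV f" "f differentiable_on UNIV"
      "AE x in \<mu>. (norm (grad u (A x)))\<^sup>2 = deriv f ((norm x)\<^sup>2)"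
      using rad by (auto simp: radial_maps_def)
    have cf: "continuous_on UNIV f" by (rule convex_on_continuous[OF open_UNIV f(1)])
    have cp: "continuous_on UNIV (\<lambda>x :: real^'p. (norm x)\<^sup>2)" and cq: "continuous_on UNIV (\<lambda>y :: real^'q. (norm y)\<^sup>2)"
      by (intro continuous_intros)+
    have "GDERIV f s :> deriv f s" for s
      using f(2) by (simp add: differentiable_on_def DERIV_deriv_iff_real_differentiable)
    then have tangent: "f s + deriv f s \<bullet> (w - s) \<le> f w" for s w
      by (rule convex_on_above_tangent_plane[OF f(1)])
    \<comment> \<open>The same criterion in dimension one, with \<open>a\<close> and
      \<open>b\<close> the squared norms; the inner product of reals is their product.\<close>
    have "AE x in \<mu>. \<forall>w. f ((norm x)\<^sup>2) + (norm (grad u (A x)))\<^sup>2 \<bullet> (w - (norm x)\<^sup>2) \<le> f w"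
      using f(3)
    proof eventually_elim
      case (elim x)
      show ?case unfolding elim by (intro allI tangent)
    qed
    then have "AE z in \<gamma>. \<forall>w. f ((norm (fst z))\<^sup>2) + (norm (snd z))\<^sup>2 \<bullet> (w - (norm (fst z))\<^sup>2) \<le> f w"
      unfolding \<gamma>_def
      by (rule AE_graph_coupling_subgradient[OF T cp cq cf])
    then have "(\<integral>z. (norm (fst z))\<^sup>2 \<bullet> (norm (snd z))\<^sup>2 \<partial>\<pi>opt) \<le> (\<integral>z. (norm (fst z))\<^sup>2 \<bullet> (norm (snd z))\<^sup>2 \<partial>\<gamma>)"
      by (rule subgradient_coupling_maximal[OF opt(1) \<gamma> cp cq cf])
    then have quad: "S \<pi>opt \<le> S \<gamma>" by (simp add: S_def)
    note objective = bilinear_objective_eq[OF marginals, folded M_def S_def]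
    \<comment> \<open>Pass from the best matrix for \<open>\<pi>\<close> to the optimal pair, then
      to \<open>\<gamma>\<close> with the same \<open>Popt\<close>, then to the best matrix for
      \<open>\<gamma>\<close>.\<close>
    have le: "S \<pi> + 2 * (norm (M \<pi>))\<^sup>2 \<le> S \<gamma> + 2 * (norm (M \<gamma>))\<^sup>2" if \<pi>: "\<pi> \<in> couplings \<mu> \<nu>" for \<pi>
    proof -
      have "S \<pi> + 2 * (norm (M \<pi>))\<^sup>2 = bilinear_objective \<pi> (4 *\<^sub>R M \<pi>)"
        unfolding objective[OF \<pi>] using inner_minus_norm_sq_le(2)[of "M \<pi>"] by linarith
      also have "\<dots> \<le> bilinear_objective \<pi>opt Popt" by (rule opt(2)[OF \<pi>])
      also have "\<dots> \<le> bilinear_objective \<gamma> Popt"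
        using bil quad by (simp add: objective opt(1) \<gamma>)
      also have "\<dots> \<le> S \<gamma> + 2 * (norm (M \<gamma>))\<^sup>2"
        unfolding objective[OF \<gamma>] using inner_minus_norm_sq_le(1)[of Popt "M \<gamma>"] by linarith
      finally show ?thesis .
    qed
    obtain C where C: "\<And>\<pi>. \<pi> \<in> couplings \<mu> \<nu> \<Longrightarrow> gw_cost \<pi> = C - 4 * S \<pi> - 8 * (norm (M \<pi>))\<^sup>2"
      using gw_cost_eq[OF marginals assms(7,8)] unfolding M_def S_def by blast
    \<comment> \<open>Up to \<open>C\<close>, the cost is -4 times the quantity compared in
      \<open>le\<close>.\<close>
    have "gw_cost \<gamma> \<le> gw_cost \<pi>" if "\<pi> \<in> couplings \<mu> \<nu>" for \<pi>
      using le[OF that] C[OF that] C[OF \<gamma>] by linarith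
    then show ?thesis
      using \<gamma> unfolding is_arg_min_def \<gamma>_def[symmetric] by (auto simp: not_less)
  qed
  show ?thesis
    using part1 part2 unfolding A_def by blast
qed

end
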